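(* Let $T>0$, $L\in\mathbb{N}$, and let $\psi:\mathbb{R}^L\times(0,\infty)\times\mathbb{R}\to\mathbb{R}$ satisfy the hypothesis on $\psi$ stated in the context. Let $\mathbf{u}\in C([0,T];\mathbb{R}^L)$ and $w\in C[0,T]$ be given, and let $q\in G_R[0,T]$ be the solution of $$q(t)+\mathcal{P}(\mathbf{u})[q](t)=w(t),\qquad t\in[0,T].$$ Then $q$ belongs to $C[0,T]$. If, in addition, $\mathbf{u}$ and $w$ are absolutely continuous, then $q$ is absolutely continuous.
   Context: Regulated functions. A function $w$ on $[0,T]$ is regulated if both one-sided limits $w(t+),w(t-)$ exist at every $t\in[0,T]$, with the convention $w(T+)=w(T)$, $w(0-)=w(0)$. $G[0,T]$ is the space of real-valued regulated functions, $G_R[0,T]$ the space of right-continuous real-valued regulated functions, $G_R([0,T];\mathbb{R}^L)$ the space of right-continuous regulated functions with values in $\mathbb{R}^L$, and $BV_R[0,T]=BV[0,T]\cap G_R[0,T]$, where $BV[0,T]$ is the space of functions of bounded variation. $C[0,T]$ and $C([0,T];\mathbb{R}^L)$ are the spaces of continuous real-valued and $\mathbb{R}^L$-valued functions. Put $|w|_{[s,t]}=\sup_{\tau\in[s,t]}|w(\tau)|$; $\|\cdot\|$ is the Euclidean norm in $\mathbb{R}^L$. Play operator. For $r>0$ and $q\in G_R[0,T]$, $\mathfrak{p}_r[q]=\xi_r$ denotes the unique $\xi_r\in BV_R[0,T]$ such that $|q(t)-\xi_r(t)|\le r$ for all $t\in[0,T]$, $\int_0^T(q(t)-\xi_r(t)-z(t))\,\mathrm{d}\xi_r(t)\ge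 0$ (Kurzweil-Stieltjes integral) for every $z\in G[0,T]$ with $|z|_{[0,T]}\le r$, and $\xi_r(0)=\max\{q(0)-r,\min\{0,q(0)+r\}\}$. Hypothesis on $\psi$. $\psi$ is measurable; for almost every $(r,v)\in(0,\infty)\times\mathbb{R}$ the function $\mathbf{u}\mapsto\psi(\mathbf{u},r,v)$ is differentiable on $\mathbb{R}^L$ and for all $\mathbf{u}\in\mathbb{R}^L$: (i) $0\le\psi(\mathbf{u},r,v)\le\mu(r)$, where $\mu\in L^1(0,\infty)$; (ii) $\|\nabla_{\mathbf{u}}\psi(\mathbf{u},r,v)\|\le K(r,v)$, where $K\in L^1((0,\infty)\times\mathbb{R})$. Parameter-dependent Preisach operator. For $\mathbf{u}\in G_R([0,T];\mathbb{R}^L)$ and $q\in G_R[0,T]$, $$\mathcal{P}(\mathbf{u})[q](t)=\int_0^\infty\int_0^{\xi_r(t)}\psi(\mathbf{u}(t),r,v)\,\mathrm{d}v\,\mathrm{d}r,\qquad \xi_r=\mathfrak{p}_r[q],\quad t\in[0,T],$$ where the inner integral is oriented (one has $\xi_r(t)=0$ for $r\ge|q|_{[0,T]}$). If $\psi$ is measurable and, for almost every $(r,v)\in(0,\infty)\times\mathbb{R}$, the function $\mathbf{u}\mapsto\psi(\mathbf{u},r,v)$ is differentiable on $\mathbb{R}^L$ with $0\le\psi(\mathbf{u},r,v)\le\mu(r)$ and $\|\nabla_{\mathbf{u}}\psi(\mathbf{u},r,v)\|\le K(r,v)$ for all $\mathbf{u}\in\mathbb{R}^L$, where $\mu\in L^1(0,\infty)$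 and $K\in L^1((0,\infty)\times\mathbb{R})$, then for every $\mathbf{u}\in G_R([0,T];\mathbb{R}^L)$ and $w\in G_R[0,T]$ the equation $q+\mathcal{P}(\mathbf{u})[q]=w$ has a unique solution $q\in G_R[0,T]$; this is what "the solution" refers to. *)

theory Defs
  imports "HOL-Analysis.Analysis"
begin

text \<open>
  Functions on an interval \<open>[a,b]\<close> are represented by total functions on the reals; all notions
  below depend only on their values on \<open>[a,b]\<close>.
\<close>

text \<open>
  By the conventions \<open>w(b+) = w(b)\<close> and \<open>w(a-) = w(a)\<close>, the one-sided limits that point out
  of \<open>[a,b]\<close> impose no condition.
\<close>

definition regulated_on :: "real \<Rightarrow> real \<Rightarrow> (real \<Rightarrow> 'a::topological_space) \<Rightarrow> bool" where
  "regulated_on a b w \<longleftrightarrow>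
     (\<forall>t\<in>{a..<b}. \<exists>l. (w \<longlongrightarrow> l) (at_right t)) \<and>
     (\<forall>t\<in>{a<..b}. \<exists>l. (w \<longlongrightarrow> l) (at_left t))"

definition right_continuous_on :: "real \<Rightarrow> real \<Rightarrow> (real \<Rightarrow> 'a::topological_space) \<Rightarrow> bool" where
  "right_continuous_on a b w \<longleftrightarrow> (\<forall>t\<in>{a..<b}. (w \<longlongrightarrow> w t) (at_right t))"

definition G_R :: "real \<Rightarrow> (real \<Rightarrow> real) set" where
  "G_R T = {w. regulated_on 0 T w \<and> right_continuous_on 0 T w}"

text \<open>
  Partitions are rendered by the library's divisions; a cell \<open>K\<close> is the interval
  \<open>[Inf K, Sup K]\<close>, and degenerate cells contribute \<open>0\<close> to all sums below.
\<close>

definition bounded_variation_on :: "real \<Rightarrow> real \<Rightarrow> (real \<Rightarrow> real) \<Rightarrow> bool" where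
  "bounded_variation_on a b w \<longleftrightarrow>
     (\<exists>M. \<forall>D. D division_of {a..b} \<longrightarrow> (\<Sum>K\<in>D. \<bar>w (Sup K) - w (Inf K)\<bar>) \<le> M)"

definition BV_R :: "real \<Rightarrow> (real \<Rightarrow> real) set" where
  "BV_R T = {w \<in> G_R T. bounded_variation_on 0 T w}"

definition abs_continuous_on :: "real \<Rightarrow> real \<Rightarrow> (real \<Rightarrow> 'a::real_normed_vector) \<Rightarrow> bool" where
  "abs_continuous_on a b f \<longleftrightarrow>
     (\<forall>\<epsilon>>0. \<exists>\<delta>>0. \<forall>D S. D division_of S \<and> S \<subseteq> {a..b} \<and> (\<Sum>K\<in>D. Sup K - Inf K) < \<delta> \<longrightarrow>
        (\<Sum>K\<in>D. norm (f (Sup K) - f (Inf K))) < \<epsilon>)"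

text \<open>
  The Kurzweil--Stieltjes integral of \<open>f\<close> with respect to \<open>g\<close> over \<open>[a,b]\<close> exists and equals
  \<open>I\<close>.
\<close>

definition has_KS_integral ::
    "(real \<Rightarrow> real) \<Rightarrow> (real \<Rightarrow> real) \<Rightarrow> real \<Rightarrow> real \<Rightarrow> real \<Rightarrow> bool" where
  "has_KS_integral f g a b I \<longleftrightarrow>
     (\<forall>\<epsilon>>0. \<exists>\<gamma>. gauge \<gamma> \<and>
        (\<forall>\<D>. \<D> tagged_division_of {a..b} \<and> \<gamma> fine \<D> \<longrightarrow>
           \<bar>(\<Sum>(x,K)\<in>\<D>. f x * (g (Sup K) - g (Inf K))) - I\<bar> < \<epsilon>))"

definition is_play :: "real \<Rightarrow> real \<Rightarrow> (real \<Rightarrow> real) \<Rightarrow> (real \<Rightarrow> real) \<Rightarrow> bool" where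
  "is_play T r q \<xi> \<longleftrightarrow>
     \<xi> \<in> BV_R T \<and>
     (\<forall>t\<in>{0..T}. \<bar>q t - \<xi> t\<bar> \<le> r) \<and>
     (\<forall>z. regulated_on 0 T z \<and> (\<forall>t\<in>{0..T}. \<bar>z t\<bar> \<le> r) \<longrightarrow>
        (\<exists>I\<ge>0. has_KS_integral (\<lambda>t. q t - \<xi> t - z t) \<xi> 0 T I)) \<and>
     \<xi> 0 = max (q 0 - r) (min 0 (q 0 + r))"

text \<open>
  The conditions determine \<open>\<xi>\<close> on \<open>[0,T]\<close> only, so a description operator requiring a
  unique total function is not applicable; the values outside \<open>[0,T]\<close> are irrelevant.
\<close>

definition play :: "real \<Rightarrow> real \<Rightarrow> (real \<Rightarrow> real) \<Rightarrow> real \<Rightarrow> real" where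
  "play T r q = (SOME \<xi>. is_play T r q \<xi>)"

definition preisach_density :: "(real ^ 'l::finite \<Rightarrow> real \<Rightarrow> real \<Rightarrow> real) \<Rightarrow> bool" where
  "preisach_density \<psi> \<longleftrightarrow>
     (\<lambda>(u, r, v). \<psi> u r v) \<in> borel_measurable (lebesgue_on (UNIV \<times> {0<..} \<times> UNIV)) \<and>
     (\<exists>\<mu> K.
        integrable (lebesgue_on {0<..}) \<mu> \<and>
        integrable (lebesgue_on ({0<..} \<times> UNIV)) (\<lambda>(r, v). K r v) \<and>
        (AE (r, v) in lebesgue_on ({0<..} \<times> UNIV). \<forall>u.
           0 \<le> \<psi> u r v \<and> \<psi> u r v \<le> \<mu> r \<and>
           (\<exists>D. GDERIV (\<lambda>u. \<psi> u r v) u :> D \<and> norm D \<le> K r v)))"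

text \<open>The inner interval integral is oriented, i.e. it changes sign for negative upper limit.\<close>

definition preisach ::
    "real \<Rightarrow> (real ^ 'l::finite \<Rightarrow> real \<Rightarrow> real \<Rightarrow> real) \<Rightarrow> (real \<Rightarrow> real ^ 'l) \<Rightarrow>
      (real \<Rightarrow> real) \<Rightarrow> real \<Rightarrow> real" where
  "preisach T \<psi> u q t =
     (LINT r:{0<..}|lebesgue. LINT v=0..ereal (play T r q t)|lebesgue. \<psi> (u t) r v)"

end

theory Submission
  imports Defs
begin

text \<open>
  The Preisach term moves in the same direction as \<open>q\<close>, so it can only damp the changes of \<open>q\<close> that
  \<open>w\<close> and \<open>u\<close> impose. Let \<open>s \<le> t\<close> and suppose that \<open>q\<close> stays above \<open>q s - \<delta>\<close> on \<open>[s,t]\<close>. Then no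
  play \<open>\<xi>\<^sub>r\<close> decreases by more than \<open>\<delta>\<close> between \<open>s\<close> and \<open>t\<close>, and since \<open>0 \<le> \<psi> \<le> \<mu>\<close>, the passage from
  \<open>\<xi>\<^sub>r(s)\<close> to \<open>\<xi>\<^sub>r(t)\<close> lowers the double integral by at most \<open>\<delta> \<integral>\<mu>\<close>. The passage from \<open>u(s)\<close> to \<open>u(t)\<close>
  changes it by at most \<open>\<bar>u(t) - u(s)\<bar> \<integral>K\<close>. Subtracting the equation at the two times gives
  \<open>q(t) - q(s) \<le> \<bar>w(t) - w(s)\<bar> + C \<bar>u(t) - u(s)\<bar> + A \<delta>\<close>
  and the mirror image of this estimate (\<open>preisach_equation_increment\<close>).

  Both claims follow. If \<open>q\<close> jumped at \<open>t\<close>, say upwards, then \<open>\<delta>\<close> could be taken arbitrarily small as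
  \<open>s\<close> increases to \<open>t\<close>, and the right-hand side would tend to \<open>0\<close>, a contradiction. Once \<open>q\<close> is
  continuous, the estimate with \<open>\<delta> = 0\<close> between a minimum and a maximum of \<open>q\<close> in a cell, taken in the
  order in which they occur, bounds the oscillation of \<open>q\<close> on the cell by the increments of \<open>w\<close> and
  \<open>u\<close> over a subcell. Subcells have no larger total length, so absolute continuity carries over.

  Two ingredients have to be extracted from the definition of the play by a Stieltjes inequality.
  First, its motion: testing with \<open>z = q - \<xi> - d\<close> on an interval and \<open>z = q - \<xi>\<close> elsewhere shows that
  \<open>d\<close> times the increment of \<open>\<xi>\<close> over the interval is nonnegative. Applied after the last passage
  through a level, this proves that \<open>\<xi>\<close> moves up only where \<open>q - \<xi> = r\<close> and down only where
  \<open>q - \<xi> = -r\<close> (\<open>play_moves_only_at_threshold\<close>), and that plays are \<open>1\<close>-Lipschitz in the threshold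
  (\<open>play_Lipschitz_threshold\<close>), which makes the integrand of the Preisach operator measurable in \<open>r\<close>.

  Second, existence (\<open>is_play_exists\<close>): the play is a choice among the solutions of the inequality,
  so none of its properties is available before a solution is found. The supremum formula
  \<open>\<xi>(t) = sup\<^sub>s min (q(s) - r) (inf\<^sub>[\<^sub>s\<^sub>,\<^sub>t\<^sub>] q + r)\<close>, modified at \<open>s = 0\<close> to meet the initial condition,
  gives a function with the right motion. That motion alone makes it regulated, right-continuous and
  monotone on every interval on which \<open>q\<close> varies little, hence of bounded variation. The integral and
  its sign are obtained from approximate primitives, which are built near each point and concatenated
  along \<open>[0,T]\<close>.
\<close>

section \<open>Continuous induction and one-sided limits\<close>

text \<open>
  Continuous induction for properties of intervals: the supremum of all \<open>t\<close> with \<open>Q a t\<close> is reached by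
  a left neighbourhood and can be passed by a right one. It replaces a compactness argument whenever
  something is built from pieces on which a regulated function is nearly constant.
\<close>

lemma interval_concat_induct:
  fixes Q :: "real \<Rightarrow> real \<Rightarrow> bool"
  assumes "a \<le> b"
    and refl: "\<And>x. Q x x"
    and trans: "\<And>x y z. x < y \<Longrightarrow> y < z \<Longrightarrow> a \<le> x \<Longrightarrow> z \<le> b \<Longrightarrow> Q x y \<Longrightarrow> Q y z \<Longrightarrow> Q x z"
    and right: "\<And>x. a \<le> x \<Longrightarrow> x < b \<Longrightarrow> \<exists>y. x < y \<and> y \<le> b \<and> Q x y"
    and left: "\<And>x. a < x \<Longrightarrow> x \<le> b \<Longrightarrow> \<exists>d<x. a \<le> d \<and> (\<forall>y. d < y \<and> y < x \<longrightarrow> Q y x)"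
  shows "Q a b"
proof -
  define S where "S = {t \<in> {a..b}. Q a t}"
  define s where "s = Sup S"
  have S: "a \<in> S" "bdd_above S"
    using assms(1) refl[of a] by (simp add: S_def, intro bdd_aboveI[of _ b]) (simp add: S_def)
  have "S \<noteq> {}" using S by blast
  have "a \<le> s" unfolding s_def by (rule cSup_upper[OF S])
  moreover have "s \<le> b" unfolding s_def by (rule cSup_least[OF \<open>S \<noteq> {}\<close>]) (simp add: S_def)
  ultimately have s: "a \<le> s" "s \<le> b" .
  have Qs: "Q a s"
  proof (cases "a = s")
    case False
    then obtain d where d: "d < s" "a \<le> d" "\<And>y. d < y \<Longrightarrow> y < s \<Longrightarrow> Q y s"
      using left[of s] s by auto
    obtain t where t: "t \<in> S" "d < t" using less_cSupD[OF \<open>S \<noteq> {}\<close>, of d] d(1) unfolding s_def by blast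
    have "t \<le> s" unfolding s_def by (rule cSup_upper[OF t(1) S(2)])
    then show ?thesis
      using t d(3)[of t] trans[of a t s] s d by (cases "t = s") (auto simp: S_def)
  qed (auto simp: refl)
  have "s = b"
  proof (rule ccontr)
    assume "s \<noteq> b"
    then obtain y where y: "s < y" "y \<le> b" "Q s y" using right[of s] s by auto
    then have "Q a y" using trans[of a s y] s Qs by (cases "a = s") auto
    then have "y \<in> S" using y s by (auto simp: S_def)
    from cSup_upper[OF this S(2)] show False using y by (simp add: s_def)
  qed
  then show ?thesis using Qs by simp
qed

lemma tendsto_at_right_real_iff:
  fixes f :: "real \<Rightarrow> real"
  shows "(f \<longlongrightarrow> l) (at_right c) \<longleftrightarrow> (\<forall>e>0. \<exists>d>c. \<forall>y. c < y \<and> y < d \<longrightarrow> \<bar>f y - l\<bar> < e)"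
  unfolding tendsto_iff dist_real_def eventually_at_right_field by meson

lemma tendsto_at_left_real_iff:
  fixes f :: "real \<Rightarrow> real"
  shows "(f \<longlongrightarrow> l) (at_left c) \<longleftrightarrow> (\<forall>e>0. \<exists>d<c. \<forall>y. d < y \<and> y < c \<longrightarrow> \<bar>f y - l\<bar> < e)"
  unfolding tendsto_iff dist_real_def eventually_at_left_field by meson

lemma left_limit_of_Cauchy:
  fixes f :: "real \<Rightarrow> real"
  assumes "\<And>e. e > 0 \<Longrightarrow> \<exists>d<c. \<forall>x y. d < x \<and> x < y \<and> y < c \<longrightarrow> \<bar>f y - f x\<bar> \<le> e"
  shows "\<exists>l. (f \<longlongrightarrow> l) (at_left c)"
proof -
  have "cauchy_filter (filtermap f (at_left c))"
    unfolding cauchy_filter_metric_filtermap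
  proof (intro allI impI)
    fix e :: real assume "e > 0"
    then obtain d where d: "d < c" "\<And>x y. d < x \<Longrightarrow> x < y \<Longrightarrow> y < c \<Longrightarrow> \<bar>f y - f x\<bar> \<le> e/2"
      using assms[of "e/2"] by (metis half_gt_zero)
    have "dist (f x) (f y) < e" if "x \<in> {d<..<c}" "y \<in> {d<..<c}" for x y
      using that d(2)[of x y] d(2)[of y x] \<open>e > 0\<close>
      by (cases x y rule: linorder_cases) (auto simp: dist_real_def abs_minus_commute)
    moreover have "\<forall>\<^sub>F x in at_left c. x \<in> {d<..<c}"
      using d(1) by (auto simp: eventually_at_left_field)
    ultimately show "\<exists>P. eventually P (at_left c) \<and> (\<forall>x y. P x \<and> P y \<longrightarrow> dist (f x) (f y) < e)"
      by blast
  qed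
  then have "\<exists>l\<in>UNIV. filtermap f (at_left c) \<le> nhds l"
    using complete_UNIV[where 'a=real] unfolding complete_uniform
    by (metis filtermap_bot_iff principal_eq_bot_iff top_greatest top_eq_principal_UNIV trivial_limit_at_left_real)
  then show ?thesis by (auto simp: filterlim_def)
qed

text \<open>
  Before ending above the level \<open>d\<close>, a function that starts below it passes \<open>d\<close> for a last time. The
  supremum \<open>a\<close> of the times at which it is below may or may not be such a time; in the second case the
  function jumps over \<open>d\<close> at \<open>a\<close>, and only its left limit is known to be below.
\<close>

lemma last_passage_cases:
  fixes f :: "real \<Rightarrow> real"
  assumes st: "s \<le> t" "f s \<le> d" "d < f t"
  obtains (attained) a where "s \<le> a" "a < t" "f a \<le> d" "\<And>x. a < x \<Longrightarrow> x \<le> t \<Longrightarrow> d < f x"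
    | (jump) a where "s < a" "a \<le> t" "\<And>l. (f \<longlongrightarrow> l) (at_left a) \<Longrightarrow> l \<le> d"
        "\<And>x. a \<le> x \<Longrightarrow> x \<le> t \<Longrightarrow> d < f x"
proof -
  define S where "S = {x \<in> {s..t}. f x \<le> d}"
  define a where "a = Sup S"
  have S: "s \<in> S" "bdd_above S" "S \<noteq> {}"
    using st by (auto simp: S_def intro: bdd_aboveI[of _ t])
  have "s \<le> a" unfolding a_def by (rule cSup_upper[OF S(1,2)])
  moreover have "a \<le> t" unfolding a_def by (rule cSup_least[OF S(3)]) (simp add: S_def)
  ultimately have a: "s \<le> a" "a \<le> t" .
  have after: "d < f x" if "a < x" "x \<le> t" for x
  proof (rule ccontr)
    assume "\<not> d < f x"
    then have "x \<in> S" using that a by (auto simp: S_def)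
    from cSup_upper[OF this S(2)] that show False by (simp add: a_def)
  qed
  show thesis
  proof (cases "f a \<le> d")
    case True
    then have "a \<noteq> t" using st by auto
    then show ?thesis using attained[of a] True a after by auto
  next
    case False
    have "l \<le> d" if l: "(f \<longlongrightarrow> l) (at_left a)" for l
    proof (rule ccontr)
      assume "\<not> l \<le> d"
      then have "\<forall>\<^sub>F x in at_left a. d < f x" using order_tendstoD(1)[OF l] by simp
      then obtain b where b: "b < a" "\<And>y. b < y \<Longrightarrow> y < a \<Longrightarrow> d < f y"
        unfolding eventually_at_left_field by blast
      obtain y where y: "y \<in> S" "b < y" using less_cSupD[OF S(3), of b] b(1) unfolding a_def by blast
      have "y \<le> a" unfolding a_def by (rule cSup_upper[OF y(1) S(2)])
      then show False using y b(2)[of y] False by (cases "y = a") (auto simp: S_def)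
    qed
    moreover have "a \<noteq> s" using False st by auto
    moreover have "d < f x" if "a \<le> x" "x \<le> t" for x
      using after[of x] that False by (cases "x = a") auto
    ultimately show ?thesis using jump[of a] a by auto
  qed
qed

lemma G_RD:
  assumes "q \<in> G_R T"
  shows "\<And>t. 0 \<le> t \<Longrightarrow> t < T \<Longrightarrow> (q \<longlongrightarrow> q t) (at_right t)"
    and "\<And>t. 0 < t \<Longrightarrow> t \<le> T \<Longrightarrow> \<exists>l. (q \<longlongrightarrow> l) (at_left t)"
    and "regulated_on 0 T q"
  using assms by (simp_all add: G_R_def regulated_on_def right_continuous_on_def)

text \<open>
  Near each point a regulated function is within distance \<open>1\<close> of its one-sided limits, so local bounds
  exist and the larger of two bounds serves for a union.
\<close>

lemma G_R_bounded:
  assumes q: "q \<in> G_R T" and T: "0 \<le> T"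
  obtains B where "B \<ge> 0" "\<And>t. 0 \<le> t \<Longrightarrow> t \<le> T \<Longrightarrow> \<bar>q t\<bar> \<le> B"
proof -
  let ?Q = "\<lambda>x y. \<exists>B. \<forall>t. x \<le> t \<and> t \<le> y \<longrightarrow> \<bar>q t\<bar> \<le> B"
  have "?Q 0 T"
    using T
  proof (rule interval_concat_induct)
    show "?Q x x" for x by (intro exI[of _ "\<bar>q x\<bar>"]) (metis order_antisym order_refl)
    show "?Q x z" if Q: "?Q x y" "?Q y z" for x y z
    proof -
      from Q obtain B B' where "\<forall>t. x \<le> t \<and> t \<le> y \<longrightarrow> \<bar>q t\<bar> \<le> B" "\<forall>t. y \<le> t \<and> t \<le> z \<longrightarrow> \<bar>q t\<bar> \<le> B'"
        by blast
      then have "\<bar>q t\<bar> \<le> max B B'" if "x \<le> t \<and> t \<le> z" for t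
        using that by (cases "t \<le> y") (auto simp: le_max_iff_disj)
      then show ?thesis by blast
    qed
    show "\<exists>y. x < y \<and> y \<le> T \<and> ?Q x y" if x: "0 \<le> x" "x < T" for x
    proof -
      obtain d where d: "d > x" "\<And>y. x < y \<Longrightarrow> y < d \<Longrightarrow> \<bar>q y - q x\<bar> < 1"
        using G_RD(1)[OF q x] unfolding tendsto_at_right_real_iff by (meson zero_less_one)
      define y where "y = (x + min d T) / 2"
      have y: "x < y" "y < d" "y \<le> T" using d x by (auto simp: y_def)
      have "\<bar>q t\<bar> \<le> \<bar>q x\<bar> + 1" if "x \<le> t \<and> t \<le> y" for t
        using d(2)[of t] y that by (cases "t = x") auto
      then show ?thesis using y by blast
    qed
    show "\<exists>d<x. 0 \<le> d \<and> (\<forall>y. d < y \<and> y < x \<longrightarrow> ?Q y x)" if x: "0 < x" "x \<le> T" for x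
    proof -
      obtain l where "(q \<longlongrightarrow> l) (at_left x)" using G_RD(2)[OF q x] by blast
      then obtain d where d: "d < x" "\<And>y. d < y \<Longrightarrow> y < x \<Longrightarrow> \<bar>q y - l\<bar> < 1"
        unfolding tendsto_at_left_real_iff by (meson zero_less_one)
      have "\<bar>q t\<bar> \<le> \<bar>l\<bar> + \<bar>q x\<bar> + 1" if "d < y \<and> y < x" "y \<le> t \<and> t \<le> x" for y t
        using d(2)[of t] that by (cases "t = x") auto
      then have "\<forall>y. d < y \<and> y < x \<longrightarrow> ?Q y x" by blast
      then show ?thesis using d(1) x by (intro exI[of _ "max d 0"]) auto
    qed
  qed
  then obtain B where B: "\<And>t. 0 \<le> t \<Longrightarrow> t \<le> T \<Longrightarrow> \<bar>q t\<bar> \<le> B" by blast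
  moreover have "0 \<le> B" using B[of 0] T by simp
  ultimately show thesis using that by blast
qed

lemma regulated_on_lincomb:
  fixes f h :: "real \<Rightarrow> real"
  assumes "regulated_on a b f" "regulated_on a b h"
  shows "regulated_on a b (\<lambda>x. f x + k * h x)"
proof -
  have lim: "\<exists>l. ((\<lambda>x. f x + k * h x) \<longlongrightarrow> l) G"
    if "\<exists>l. (f \<longlongrightarrow> l) G" "\<exists>l. (h \<longlongrightarrow> l) G" for G
  proof -
    from that obtain l m where "(f \<longlongrightarrow> l) G" "(h \<longlongrightarrow> m) G" by blast
    then have "((\<lambda>x. f x + k * h x) \<longlongrightarrow> l + k * m) G" by (intro tendsto_intros)
    then show ?thesis by blast
  qed
  show ?thesis using assms lim unfolding regulated_on_def by simp
qed

definition step_after :: "real \<Rightarrow> real \<Rightarrow> real" where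
  "step_after c x = (if c < x then 1 else 0)"

definition step_from :: "real \<Rightarrow> real \<Rightarrow> real" where
  "step_from c x = (if c \<le> x then 1 else 0)"

lemma regulated_on_step_after: "regulated_on a b (step_after c)"
  unfolding regulated_on_def
proof (intro conjI ballI)
  fix t
  have "(step_after c \<longlongrightarrow> step_from c t) (at_right t)"
    unfolding tendsto_at_right_real_iff step_after_def step_from_def
    by (cases "c \<le> t") (auto intro: exI[of _ c] exI[of _ "t+1"])
  then show "\<exists>l. (step_after c \<longlongrightarrow> l) (at_right t)" by blast
  have "(step_after c \<longlongrightarrow> step_after c t) (at_left t)"
    unfolding tendsto_at_left_real_iff step_after_def
    by (cases "c < t") (auto intro: exI[of _ c] exI[of _ "t-1"])
  then show "\<exists>l. (step_after c \<longlongrightarrow> l) (at_left t)" by blast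
qed

lemma regulated_on_step_from: "regulated_on a b (step_from c)"
  unfolding regulated_on_def
proof (intro conjI ballI)
  fix t
  have "(step_from c \<longlongrightarrow> step_from c t) (at_right t)"
    unfolding tendsto_at_right_real_iff step_from_def
    by (cases "c \<le> t") (auto intro: exI[of _ c] exI[of _ "t+1"])
  then show "\<exists>l. (step_from c \<longlongrightarrow> l) (at_right t)" by blast
  have "(step_from c \<longlongrightarrow> step_after c t) (at_left t)"
    unfolding tendsto_at_left_real_iff step_after_def step_from_def
    by (cases "c < t") (auto intro: exI[of _ c] exI[of _ "t-1"])
  then show "\<exists>l. (step_from c \<longlongrightarrow> l) (at_left t)" by blast
qed

section \<open>Kurzweil--Stieltjes integrals\<close>

text \<open>
  The defining estimate of the integral for a fixed gauge and a fixed error; it also makes sense when \<open>I\<close>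
  is only an approximate value.
\<close>

definition KS_within ::
    "(real \<Rightarrow> real) \<Rightarrow> (real \<Rightarrow> real) \<Rightarrow> real \<Rightarrow> real \<Rightarrow> (real \<Rightarrow> real set) \<Rightarrow> real \<Rightarrow> real \<Rightarrow> bool" where
  "KS_within f g a b \<gamma> I e \<longleftrightarrow> gauge \<gamma> \<and>
     (\<forall>\<D>. \<D> tagged_division_of {a..b} \<and> \<gamma> fine \<D> \<longrightarrow>
        \<bar>(\<Sum>(x,K)\<in>\<D>. f x * (g (Sup K) - g (Inf K))) - I\<bar> \<le> e)"

lemma has_KS_integral_iff_within:
  "has_KS_integral f g a b I \<longleftrightarrow> (\<forall>\<epsilon>>0. \<exists>\<gamma>. KS_within f g a b \<gamma> I \<epsilon>)"
proof
  assume "has_KS_integral f g a b I"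
  then show "\<forall>\<epsilon>>0. \<exists>\<gamma>. KS_within f g a b \<gamma> I \<epsilon>"
    unfolding has_KS_integral_def KS_within_def by (meson less_imp_le)
next
  assume within: "\<forall>\<epsilon>>0. \<exists>\<gamma>. KS_within f g a b \<gamma> I \<epsilon>"
  show "has_KS_integral f g a b I"
    unfolding has_KS_integral_def
  proof (intro allI impI)
    fix \<epsilon> :: real assume "\<epsilon> > 0"
    then obtain \<gamma> where "KS_within f g a b \<gamma> I (\<epsilon>/2)" using within by (meson half_gt_zero)
    with \<open>\<epsilon> > 0\<close> show "\<exists>\<gamma>. gauge \<gamma> \<and> (\<forall>\<D>. \<D> tagged_division_of {a..b} \<and> \<gamma> fine \<D> \<longrightarrow>
           \<bar>(\<Sum>(x,K)\<in>\<D>. f x * (g (Sup K) - g (Inf K))) - I\<bar> < \<epsilon>)"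
      unfolding KS_within_def by (intro exI[of _ \<gamma>]) force
  qed
qed

text \<open>
  A division that is fine for both gauges exists, and its sum is close to both values.
\<close>

lemma KS_within_close:
  assumes "KS_within f g a b \<gamma>1 I d" "KS_within f g a b \<gamma>2 J e"
  shows "\<bar>I - J\<bar> \<le> d + e"
proof -
  have "gauge \<gamma>1" "gauge \<gamma>2" using assms by (simp_all add: KS_within_def)
  then obtain \<D> where D: "\<D> tagged_division_of {a..b}" "(\<lambda>x. \<gamma>1 x \<inter> \<gamma>2 x) fine \<D>"
    using fine_division_exists_real[OF gauge_Int, of \<gamma>1 \<gamma>2 a b] by metis
  then have "\<gamma>1 fine \<D>" "\<gamma>2 fine \<D>" by (simp_all add: fine_Int)
  then have "\<bar>(\<Sum>(x,K)\<in>\<D>. f x * (g (Sup K) - g (Inf K))) - I\<bar> \<le> d"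
    "\<bar>(\<Sum>(x,K)\<in>\<D>. f x * (g (Sup K) - g (Inf K))) - J\<bar> \<le> e"
    using assms D(1) unfolding KS_within_def by blast+
  then show ?thesis by linarith
qed

lemma has_KS_integral_unique:
  assumes "has_KS_integral f g a b I" "has_KS_integral f g a b J"
  shows "I = J"
proof (rule ccontr)
  assume "I \<noteq> J"
  then have "\<bar>I - J\<bar> / 3 > 0" by simp
  then obtain \<gamma>1 \<gamma>2 where "KS_within f g a b \<gamma>1 I (\<bar>I - J\<bar> / 3)" "KS_within f g a b \<gamma>2 J (\<bar>I - J\<bar> / 3)"
    using assms unfolding has_KS_integral_iff_within by metis
  from KS_within_close[OF this] \<open>I \<noteq> J\<close> show False by simp
qed

lemma has_KS_integral_linear:
  assumes "has_KS_integral f g a b I" "has_KS_integral h g a b J"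
  shows "has_KS_integral (\<lambda>x. k * f x + m * h x) g a b (k * I + m * J)"
  unfolding has_KS_integral_iff_within
proof (intro allI impI)
  fix \<epsilon> :: real assume \<epsilon>: "\<epsilon> > 0"
  \<comment> \<open>the summand \<open>1\<close> keeps the denominator positive when both coefficients vanish\<close>
  define e where "e = \<epsilon> / (\<bar>k\<bar> + \<bar>m\<bar> + 1)"
  have e: "e > 0" "\<bar>k\<bar> * e + \<bar>m\<bar> * e \<le> \<epsilon>"
    using \<epsilon> by (auto simp: e_def field_simps add_pos_nonneg)
  obtain \<gamma>1 \<gamma>2 where \<gamma>: "KS_within f g a b \<gamma>1 I e" "KS_within h g a b \<gamma>2 J e"
    using assms e(1) unfolding has_KS_integral_iff_within by metis
  have "KS_within (\<lambda>x. k * f x + m * h x) g a b (\<lambda>x. \<gamma>1 x \<inter> \<gamma>2 x) (k * I + m * J) \<epsilon>"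
    unfolding KS_within_def
  proof (intro conjI allI impI)
    show "gauge (\<lambda>x. \<gamma>1 x \<inter> \<gamma>2 x)" using \<gamma> by (simp add: KS_within_def gauge_Int)
    fix \<D> assume D: "\<D> tagged_division_of {a..b} \<and> (\<lambda>x. \<gamma>1 x \<inter> \<gamma>2 x) fine \<D>"
    define S1 where "S1 = (\<Sum>(x,K)\<in>\<D>. f x * (g (Sup K) - g (Inf K)))"
    define S2 where "S2 = (\<Sum>(x,K)\<in>\<D>. h x * (g (Sup K) - g (Inf K)))"
    have "\<bar>S1 - I\<bar> \<le> e" "\<bar>S2 - J\<bar> \<le> e"
      using \<gamma> D by (simp_all add: KS_within_def fine_Int S1_def S2_def)
    then have "\<bar>k * (S1 - I)\<bar> \<le> \<bar>k\<bar> * e" "\<bar>m * (S2 - J)\<bar> \<le> \<bar>m\<bar> * e"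
      by (auto simp: abs_mult intro: mult_left_mono)
    moreover have "(\<Sum>(x,K)\<in>\<D>. (k * f x + m * h x) * (g (Sup K) - g (Inf K))) = k * S1 + m * S2"
      unfolding S1_def S2_def sum_distrib_left sum.distrib[symmetric]
      by (intro sum.cong) (auto simp: algebra_simps)
    moreover have "k * S1 + m * S2 - (k * I + m * J) = k * (S1 - I) + m * (S2 - J)"
      by (simp add: algebra_simps)
    ultimately show "\<bar>(\<Sum>(x,K)\<in>\<D>. (k * f x + m * h x) * (g (Sup K) - g (Inf K))) - (k * I + m * J)\<bar> \<le> \<epsilon>"
      using e(2) by linarith
  qed
  then show "\<exists>\<gamma>. KS_within (\<lambda>x. k * f x + m * h x) g a b \<gamma> (k * I + m * J) \<epsilon>" by blast
qed

text \<open>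
  \<open>F\<close> is an approximate indefinite integral of \<open>f\<close> with respect to \<open>g\<close>, with an error measured by the
  increments of \<open>W\<close>. The two sides of a tag are treated separately because this makes the notion stable
  under concatenation: a cell of a union of two adjacent intervals may straddle their common end, but
  its two halves at the tag do not once that end is the tag.
\<close>

definition KS_primitive ::
    "(real \<Rightarrow> real) \<Rightarrow> (real \<Rightarrow> real) \<Rightarrow> real \<Rightarrow> real \<Rightarrow> (real \<Rightarrow> real) \<Rightarrow> (real \<Rightarrow> real) \<Rightarrow> bool" where
  "KS_primitive f g a b F W \<longleftrightarrow>
     (\<forall>x\<in>{a..b}. \<exists>\<delta>>0.
        (\<forall>y\<in>{a..b}. x < y \<and> y < x + \<delta> \<longrightarrow> \<bar>f x * (g y - g x) - (F y - F x)\<bar> \<le> W y - W x) \<and>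
        (\<forall>y\<in>{a..b}. x - \<delta> < y \<and> y < x \<longrightarrow> \<bar>f x * (g x - g y) - (F x - F y)\<bar> \<le> W x - W y))"

lemma KS_primitiveI:
  assumes "\<And>x. a \<le> x \<Longrightarrow> x \<le> b \<Longrightarrow> \<exists>\<delta>>0.
      (\<forall>y. x < y \<and> y < x + \<delta> \<and> y \<le> b \<longrightarrow> \<bar>f x * (g y - g x) - (F y - F x)\<bar> \<le> W y - W x) \<and>
      (\<forall>y. x - \<delta> < y \<and> y < x \<and> a \<le> y \<longrightarrow> \<bar>f x * (g x - g y) - (F x - F y)\<bar> \<le> W x - W y)"
  shows "KS_primitive f g a b F W"
  unfolding KS_primitive_def
proof (rule ballI)
  fix x assume "x \<in> {a..b}"
  then have x: "a \<le> x" "x \<le> b" by auto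
  obtain \<delta> where "\<delta> > 0"
    "\<forall>y. x < y \<and> y < x + \<delta> \<and> y \<le> b \<longrightarrow> \<bar>f x * (g y - g x) - (F y - F x)\<bar> \<le> W y - W x"
    "\<forall>y. x - \<delta> < y \<and> y < x \<and> a \<le> y \<longrightarrow> \<bar>f x * (g x - g y) - (F x - F y)\<bar> \<le> W x - W y"
    using assms[OF x] by blast
  then show "\<exists>\<delta>>0.
        (\<forall>y\<in>{a..b}. x < y \<and> y < x + \<delta> \<longrightarrow> \<bar>f x * (g y - g x) - (F y - F x)\<bar> \<le> W y - W x) \<and>
        (\<forall>y\<in>{a..b}. x - \<delta> < y \<and> y < x \<longrightarrow> \<bar>f x * (g x - g y) - (F x - F y)\<bar> \<le> W x - W y)"
    by (intro exI[of _ \<delta>]) simp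
qed

lemma KS_primitiveE:
  assumes "KS_primitive f g a b F W" "a \<le> x" "x \<le> b"
  obtains \<delta> where "\<delta> > 0"
    "\<And>y. x < y \<Longrightarrow> y < x + \<delta> \<Longrightarrow> y \<le> b \<Longrightarrow> \<bar>f x * (g y - g x) - (F y - F x)\<bar> \<le> W y - W x"
    "\<And>y. x - \<delta> < y \<Longrightarrow> y < x \<Longrightarrow> a \<le> y \<Longrightarrow> \<bar>f x * (g x - g y) - (F x - F y)\<bar> \<le> W x - W y"
proof -
  have "x \<in> {a..b}" using assms by simp
  then obtain \<delta> where "\<delta> > 0"
    "\<forall>y\<in>{a..b}. x < y \<and> y < x + \<delta> \<longrightarrow> \<bar>f x * (g y - g x) - (F y - F x)\<bar> \<le> W y - W x"
    "\<forall>y\<in>{a..b}. x - \<delta> < y \<and> y < x \<longrightarrow> \<bar>f x * (g x - g y) - (F x - F y)\<bar> \<le> W x - W y"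
    using assms(1) unfolding KS_primitive_def by blast
  then show thesis using assms(2,3) by (intro that[of \<delta>]) auto
qed

text \<open>
  Every cell is split at its tag; the increments of \<open>F\<close> and \<open>W\<close> then telescope along the division.
\<close>

lemma KS_primitive_within:
  assumes "a \<le> b" and P: "KS_primitive f g a b F W"
  shows "\<exists>\<gamma>. KS_within f g a b \<gamma> (F b - F a) (W b - W a)"
proof -
  from P obtain \<delta> where \<delta>: "\<And>x. x \<in> {a..b} \<Longrightarrow> \<delta> x > 0"
    and R: "\<And>x y. x \<in> {a..b} \<Longrightarrow> y \<in> {a..b} \<Longrightarrow> x < y \<Longrightarrow> y < x + \<delta> x \<Longrightarrow>
              \<bar>f x * (g y - g x) - (F y - F x)\<bar> \<le> W y - W x"
    and L: "\<And>x y. x \<in> {a..b} \<Longrightarrow> y \<in> {a..b} \<Longrightarrow> x - \<delta> x < y \<Longrightarrow> y < x \<Longrightarrow>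
              \<bar>f x * (g x - g y) - (F x - F y)\<bar> \<le> W x - W y"
    unfolding KS_primitive_def by metis
  define \<gamma> where "\<gamma> = (\<lambda>x. ball x (if x \<in> {a..b} then \<delta> x else 1))"
  have "gauge \<gamma>" using \<delta> by (auto simp: \<gamma>_def gauge_def)
  moreover have "\<bar>(\<Sum>(x,K)\<in>\<D>. f x * (g (Sup K) - g (Inf K))) - (F b - F a)\<bar> \<le> W b - W a"
    if D: "\<D> tagged_division_of {a..b}" and fine: "\<gamma> fine \<D>" for \<D>
  proof -
    have cell: "\<bar>f x * (g (Sup K) - g (Inf K)) - (F (Sup K) - F (Inf K))\<bar> \<le> W (Sup K) - W (Inf K)"
      if xK: "(x,K) \<in> \<D>" for x K
    proof -
      have "x \<in> K" "K \<subseteq> {a..b}" using D xK by blast+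
      moreover obtain c d where "K = cbox c d" using tagged_division_ofD(4)[OF D xK] by blast
      moreover have "K \<subseteq> \<gamma> x" using fine xK by (auto simp: fine_def)
      ultimately have cd: "K = {c..d}" "c \<le> x" "x \<le> d" "{c..d} \<subseteq> {a..b}" "{c..d} \<subseteq> \<gamma> x"
        by auto
      then have m: "x \<in> {a..b}" "c \<in> {a..b}" "d \<in> {a..b}" "c \<in> \<gamma> x" "d \<in> \<gamma> x" by auto
      have "\<bar>f x * (g d - g x) - (F d - F x)\<bar> \<le> W d - W x"
        using R[of x d] m cd by (cases "x = d") (auto simp: \<gamma>_def dist_real_def)
      moreover have "\<bar>f x * (g x - g c) - (F x - F c)\<bar> \<le> W x - W c"
        using L[of x c] m cd by (cases "x = c") (auto simp: \<gamma>_def dist_real_def)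
      ultimately have "\<bar>f x * (g d - g c) - (F d - F c)\<bar> \<le> W d - W c"
        by (simp add: algebra_simps)
      then show ?thesis using cd by simp
    qed
    have tel: "(\<Sum>(x,K)\<in>\<D>. h (Sup K) - h (Inf K)) = h b - h a" for h :: "real \<Rightarrow> real"
      using additive_tagged_division_1[OF \<open>a \<le> b\<close> D] by blast
    have "(\<Sum>(x,K)\<in>\<D>. f x * (g (Sup K) - g (Inf K))) - (F b - F a) =
          (\<Sum>(x,K)\<in>\<D>. f x * (g (Sup K) - g (Inf K)) - (F (Sup K) - F (Inf K)))"
      by (simp add: tel[of F, symmetric] sum_subtractf split_def)
    also have "\<bar>\<dots>\<bar> \<le> (\<Sum>(x,K)\<in>\<D>. W (Sup K) - W (Inf K))"
      by (rule order_trans[OF sum_abs sum_mono]) (use cell in auto)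
    finally show ?thesis by (simp add: tel)
  qed
  ultimately have "KS_within f g a b \<gamma> (F b - F a) (W b - W a)"
    unfolding KS_within_def by simp
  then show ?thesis by (rule exI[of _ \<gamma>])
qed

lemma has_KS_integral_from_primitives:
  assumes "a \<le> b"
    and prim: "\<And>\<epsilon>. \<epsilon> > 0 \<Longrightarrow> \<exists>F W. KS_primitive f g a b F W \<and> W b - W a \<le> \<epsilon> \<and> \<bar>F b - F a - I\<bar> \<le> \<epsilon>"
  shows "has_KS_integral f g a b I"
  unfolding has_KS_integral_iff_within
proof (intro allI impI)
  fix \<epsilon> :: real assume "\<epsilon> > 0"
  then obtain F W where FW: "KS_primitive f g a b F W" "W b - W a \<le> \<epsilon>/2" "\<bar>F b - F a - I\<bar> \<le> \<epsilon>/2"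
    using prim[of "\<epsilon>/2"] by auto
  obtain \<gamma> where \<gamma>: "KS_within f g a b \<gamma> (F b - F a) (W b - W a)"
    using KS_primitive_within[OF assms(1) FW(1)] ..
  have "\<bar>S - I\<bar> \<le> \<epsilon>" if "\<bar>S - (F b - F a)\<bar> \<le> W b - W a" for S
    using that FW(2,3) by linarith
  then have "KS_within f g a b \<gamma> I \<epsilon>"
    using \<gamma> unfolding KS_within_def by simp
  then show "\<exists>\<gamma>. KS_within f g a b \<gamma> I \<epsilon>" by (rule exI[of _ \<gamma>])
qed

text \<open>
  Approximate primitives with smaller and smaller errors have total increments that form a Cauchy
  sequence, because a common fine division compares any two of them. Their limit is the integral, and
  it inherits the sign of the increments.
\<close>

lemma has_KS_integral_exists:
  assumes "a \<le> b"
    and prim: "\<And>\<epsilon>. \<epsilon> > 0 \<Longrightarrow> \<exists>F W. KS_primitive f g a b F W \<and> W b - W a \<le> \<epsilon> \<and> F b - F a \<ge> - \<epsilon>"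
  shows "\<exists>I\<ge>0. has_KS_integral f g a b I"
proof -
  define e where "e n = 1 / real (Suc n)" for n
  have e: "e n > 0" "e \<longlonglongrightarrow> 0" for n
    unfolding e_def by (simp, rule LIMSEQ_Suc[OF lim_1_over_n])
  obtain F W where FW: "\<And>n. KS_primitive f g a b (F n) (W n)" "\<And>n. W n b - W n a \<le> e n"
      "\<And>n. F n b - F n a \<ge> - e n"
    using prim[OF e(1)] by metis
  define S where "S n = F n b - F n a" for n
  have SS: "\<bar>S n - S m\<bar> \<le> e n + e m" for n m
  proof -
    obtain \<gamma>1 where "KS_within f g a b \<gamma>1 (S n) (W n b - W n a)"
      using KS_primitive_within[OF assms(1) FW(1)] unfolding S_def ..
    moreover obtain \<gamma>2 where "KS_within f g a b \<gamma>2 (S m) (W m b - W m a)"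
      using KS_primitive_within[OF assms(1) FW(1)] unfolding S_def ..
    ultimately show ?thesis using KS_within_close[of f g a b] FW(2)[of n] FW(2)[of m] by fastforce
  qed
  have "Cauchy S"
  proof (rule metric_CauchyI)
    fix \<epsilon> :: real assume "\<epsilon> > 0"
    then have "\<forall>\<^sub>F n in sequentially. e n < \<epsilon>/2" by (intro order_tendstoD(2)[OF e(2)]) auto
    then obtain N where N: "\<And>n. n \<ge> N \<Longrightarrow> e n < \<epsilon>/2" by (auto simp: eventually_sequentially)
    then show "\<exists>M. \<forall>m\<ge>M. \<forall>n\<ge>M. dist (S m) (S n) < \<epsilon>"
    proof (intro exI[of _ N] allI impI)
      fix m n assume "m \<ge> N" "n \<ge> N"
      then have "e m < \<epsilon>/2" "e n < \<epsilon>/2" using N by auto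
      then show "dist (S m) (S n) < \<epsilon>" using SS[of m n] by (simp add: dist_real_def)
    qed
  qed
  then obtain I where I: "S \<longlonglongrightarrow> I" using Cauchy_convergent_iff convergent_def by blast
  have lim: "\<bar>S n - I\<bar> \<le> e n" for n
  proof (rule LIMSEQ_le)
    show "(\<lambda>m. \<bar>S n - S m\<bar>) \<longlonglongrightarrow> \<bar>S n - I\<bar>" by (intro tendsto_intros I)
    show "(\<lambda>m. e n + e m) \<longlonglongrightarrow> e n" using tendsto_add[OF tendsto_const[of "e n"] e(2)] by simp
  qed (use SS in auto)
  have "0 \<le> I"
  proof (rule LIMSEQ_le[OF _ I])
    show "(\<lambda>n. - e n) \<longlonglongrightarrow> 0" using tendsto_minus[OF e(2)] by simp
  qed (use FW(3) in \<open>auto simp: S_def\<close>)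
  moreover have "has_KS_integral f g a b I"
  proof (rule has_KS_integral_from_primitives[OF assms(1)])
    fix \<epsilon> :: real assume "\<epsilon> > 0"
    then have "\<forall>\<^sub>F n in sequentially. e n < \<epsilon>" by (intro order_tendstoD(2)[OF e(2)]) auto
    then obtain n where "e n < \<epsilon>" by (auto simp: eventually_sequentially)
    then show "\<exists>F W. KS_primitive f g a b F W \<and> W b - W a \<le> \<epsilon> \<and> \<bar>F b - F a - I\<bar> \<le> \<epsilon>"
      using FW(1)[of n] FW(2)[of n] lim[of n] by (intro exI[of _ "F n"] exI[of _ "W n"]) (auto simp: S_def)
  qed
  ultimately show ?thesis by blast
qed

text \<open>
  The primitive is \<open>g x - g c\<close> to the right of \<open>c\<close>. At the tag \<open>c\<close>, where the integrand vanishes, a cell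
  reaching to the right contributes a small error by right continuity; it is absorbed by a jump of
  size \<open>\<epsilon>\<close> of the error function immediately after \<open>c\<close>.
\<close>

lemma has_KS_integral_step_after:
  assumes c: "a \<le> c" "c \<le> b" and g: "c < b \<Longrightarrow> (g \<longlongrightarrow> g c) (at_right c)"
  shows "has_KS_integral (step_after c) g a b (g b - g c)"
proof (rule has_KS_integral_from_primitives)
  fix \<epsilon> :: real assume \<epsilon>: "\<epsilon> > 0"
  define F where "F x = (if x \<le> c then 0 else g x - g c)" for x
  define W where "W x = (if x \<le> c then 0 else \<epsilon>)" for x
  obtain d where d: "d > c" "\<And>y. c < y \<Longrightarrow> y < d \<Longrightarrow> y \<le> b \<Longrightarrow> \<bar>g y - g c\<bar> \<le> \<epsilon>"
  proof (cases "c < b")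
    case True
    then show ?thesis using g \<epsilon> that unfolding tendsto_at_right_real_iff by (meson less_imp_le)
  qed (use that[of "c + 1"] in auto)
  have "KS_primitive (step_after c) g a b F W"
    unfolding KS_primitive_def
  proof (rule ballI)
    fix x assume x: "x \<in> {a..b}"
    define \<delta> where "\<delta> = (if x = c then d - c else \<bar>x - c\<bar>)"
    have "\<delta> > 0" using d by (auto simp: \<delta>_def)
    moreover have "\<forall>y\<in>{a..b}. x < y \<and> y < x + \<delta> \<longrightarrow>
        \<bar>step_after c x * (g y - g x) - (F y - F x)\<bar> \<le> W y - W x"
      using d(2) by (auto simp: \<delta>_def step_after_def F_def W_def split: if_splits)
    moreover have "\<forall>y\<in>{a..b}. x - \<delta> < y \<and> y < x \<longrightarrow>
        \<bar>step_after c x * (g x - g y) - (F x - F y)\<bar> \<le> W x - W y"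
      by (auto simp: \<delta>_def step_after_def F_def W_def split: if_splits)
    ultimately show "\<exists>\<delta>>0.
        (\<forall>y\<in>{a..b}. x < y \<and> y < x + \<delta> \<longrightarrow>
          \<bar>step_after c x * (g y - g x) - (F y - F x)\<bar> \<le> W y - W x) \<and>
        (\<forall>y\<in>{a..b}. x - \<delta> < y \<and> y < x \<longrightarrow>
          \<bar>step_after c x * (g x - g y) - (F x - F y)\<bar> \<le> W x - W y)" by blast
  qed
  moreover have "W b - W a \<le> \<epsilon>" "\<bar>F b - F a - (g b - g c)\<bar> \<le> \<epsilon>"
    using c \<epsilon> by (auto simp: F_def W_def)
  ultimately show "\<exists>F W. KS_primitive (step_after c) g a b F W \<and> W b - W a \<le> \<epsilon> \<and>
      \<bar>F b - F a - (g b - g c)\<bar> \<le> \<epsilon>" by blast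
qed (use c in simp)

text \<open>
  Including the point \<open>c\<close> adds the jump of \<open>g\<close> at \<open>c\<close>, since every sufficiently fine division has \<open>c\<close> as a
  tag.
\<close>

lemma has_KS_integral_step_from:
  assumes c: "a < c" "c \<le> b" and g: "(g \<longlongrightarrow> l) (at_left c)"
  shows "has_KS_integral (step_from c) g a b (g b - l)"
proof (rule has_KS_integral_from_primitives)
  fix \<epsilon> :: real assume \<epsilon>: "\<epsilon> > 0"
  define F where "F x = (if x < c then 0 else g x - l)" for x
  define W where "W x = (if x < c then 0 else \<epsilon>)" for x
  obtain d where d: "d < c" "\<And>y. d < y \<Longrightarrow> y < c \<Longrightarrow> \<bar>l - g y\<bar> \<le> \<epsilon>"
    using g \<epsilon> unfolding tendsto_at_left_real_iff by (metis abs_minus_commute less_imp_le)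
  have "KS_primitive (step_from c) g a b F W"
    unfolding KS_primitive_def
  proof (rule ballI)
    fix x assume x: "x \<in> {a..b}"
    define \<delta> where "\<delta> = (if x = c then c - d else \<bar>x - c\<bar>)"
    have "\<delta> > 0" using d by (auto simp: \<delta>_def)
    moreover have "\<forall>y\<in>{a..b}. x < y \<and> y < x + \<delta> \<longrightarrow>
        \<bar>step_from c x * (g y - g x) - (F y - F x)\<bar> \<le> W y - W x"
      by (auto simp: \<delta>_def step_from_def F_def W_def split: if_splits)
    moreover have "\<forall>y\<in>{a..b}. x - \<delta> < y \<and> y < x \<longrightarrow>
        \<bar>step_from c x * (g x - g y) - (F x - F y)\<bar> \<le> W x - W y"
      using d(2) by (auto simp: \<delta>_def step_from_def F_def W_def split: if_splits)
    ultimately show "\<exists>\<delta>>0.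
        (\<forall>y\<in>{a..b}. x < y \<and> y < x + \<delta> \<longrightarrow>
          \<bar>step_from c x * (g y - g x) - (F y - F x)\<bar> \<le> W y - W x) \<and>
        (\<forall>y\<in>{a..b}. x - \<delta> < y \<and> y < x \<longrightarrow>
          \<bar>step_from c x * (g x - g y) - (F x - F y)\<bar> \<le> W x - W y)" by blast
  qed
  moreover have "W b - W a \<le> \<epsilon>" "\<bar>F b - F a - (g b - l)\<bar> \<le> \<epsilon>"
    using c \<epsilon> by (auto simp: F_def W_def)
  ultimately show "\<exists>F W. KS_primitive (step_from c) g a b F W \<and> W b - W a \<le> \<epsilon> \<and>
      \<bar>F b - F a - (g b - l)\<bar> \<le> \<epsilon>" by blast
qed (use c in simp)

section \<open>Motion of the play\<close>

lemma is_playD: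
  assumes "is_play T r q \<xi>"
  shows "\<And>t. 0 \<le> t \<Longrightarrow> t < T \<Longrightarrow> (\<xi> \<longlongrightarrow> \<xi> t) (at_right t)"
    and "\<And>t. 0 < t \<Longrightarrow> t \<le> T \<Longrightarrow> \<exists>l. (\<xi> \<longlongrightarrow> l) (at_left t)"
    and "\<And>t. 0 \<le> t \<Longrightarrow> t \<le> T \<Longrightarrow> \<bar>q t - \<xi> t\<bar> \<le> r"
    and "\<xi> 0 = max (q 0 - r) (min 0 (q 0 + r))"
  using assms by (auto simp: is_play_def BV_R_def G_R_def regulated_on_def right_continuous_on_def)

text \<open>
  The admissible test function \<open>z = q - \<xi> - d h\<close> turns the variational inequality into a statement on
  the integral of \<open>h\<close> alone.
\<close>

lemma play_test_shift:
  assumes q: "regulated_on 0 T q" and play: "is_play T r q \<xi>"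
    and h: "regulated_on 0 T h"
    and bound: "\<And>x. x \<in> {0..T} \<Longrightarrow> \<bar>q x - \<xi> x - d * h x\<bar> \<le> r"
    and int: "has_KS_integral h \<xi> 0 T J"
  shows "0 \<le> d * J"
proof -
  define z where "z = (\<lambda>x. q x - \<xi> x - d * h x)"
  have "regulated_on 0 T \<xi>" using play by (auto simp: is_play_def BV_R_def G_R_def)
  then have "regulated_on 0 T z"
    using regulated_on_lincomb[OF regulated_on_lincomb[OF q, of \<xi> "-1"] h, of "-d"] by (simp add: z_def)
  moreover have "\<forall>t\<in>{0..T}. \<bar>z t\<bar> \<le> r" using bound by (simp add: z_def)
  ultimately obtain I where I: "I \<ge> 0" "has_KS_integral (\<lambda>t. q t - \<xi> t - z t) \<xi> 0 T I"
    using play unfolding is_play_def by blast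
  have "has_KS_integral (\<lambda>t. d * h t + 0 * h t) \<xi> 0 T (d * J + 0 * J)"
    by (rule has_KS_integral_linear[OF int int])
  then have "has_KS_integral (\<lambda>t. q t - \<xi> t - z t) \<xi> 0 T (d * J)" by (simp add: z_def)
  from has_KS_integral_unique[OF this I(2)] I(1) show ?thesis by simp
qed

text \<open>
  This is the test with the indicator of \<open>(a,t]\<close>, written as a difference of two steps. For \<open>d > 0\<close> the
  bound says that \<open>q - \<xi>\<close> stays above \<open>-r + d\<close>, and the conclusion that \<open>\<xi>\<close> has not decreased.
\<close>

lemma play_increment_after:
  assumes q: "regulated_on 0 T q" and play: "is_play T r q \<xi>"
    and at: "0 \<le> a" "a \<le> t" "t \<le> T"
    and bound: "\<And>x. a < x \<Longrightarrow> x \<le> t \<Longrightarrow> \<bar>q x - \<xi> x - d\<bar> \<le> r"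
  shows "0 \<le> d * (\<xi> t - \<xi> a)"
proof (rule play_test_shift[OF q play])
  let ?h = "\<lambda>x. step_after a x + (-1) * step_after t x"
  show "regulated_on 0 T ?h" by (intro regulated_on_lincomb regulated_on_step_after)
  show "\<bar>q x - \<xi> x - d * ?h x\<bar> \<le> r" if "x \<in> {0..T}" for x
    using bound[of x] is_playD(3)[OF play, of x] that at by (auto simp: step_after_def)
  have "has_KS_integral (\<lambda>x. 1 * step_after a x + (-1) * step_after t x) \<xi> 0 T
      (1 * (\<xi> T - \<xi> a) + (-1) * (\<xi> T - \<xi> t))"
    using at by (intro has_KS_integral_linear has_KS_integral_step_after is_playD(1)[OF play]) auto
  then show "has_KS_integral ?h \<xi> 0 T (\<xi> t - \<xi> a)" by simp
qed

text \<open>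
  The same test with the closed interval \<open>[a,t]\<close>, which captures the jump of \<open>\<xi>\<close> at \<open>a\<close> as well.
\<close>

lemma play_increment_from:
  assumes q: "regulated_on 0 T q" and play: "is_play T r q \<xi>"
    and at: "0 < a" "a \<le> t" "t \<le> T"
    and bound: "\<And>x. a \<le> x \<Longrightarrow> x \<le> t \<Longrightarrow> \<bar>q x - \<xi> x - d\<bar> \<le> r"
    and l: "(\<xi> \<longlongrightarrow> l) (at_left a)"
  shows "0 \<le> d * (\<xi> t - l)"
proof (rule play_test_shift[OF q play])
  let ?h = "\<lambda>x. step_from a x + (-1) * step_after t x"
  show "regulated_on 0 T ?h" by (intro regulated_on_lincomb regulated_on_step_after regulated_on_step_from)
  show "\<bar>q x - \<xi> x - d * ?h x\<bar> \<le> r" if "x \<in> {0..T}" for x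
    using bound[of x] is_playD(3)[OF play, of x] that at by (auto simp: step_after_def step_from_def)
  have "has_KS_integral (\<lambda>x. 1 * step_from a x + (-1) * step_after t x) \<xi> 0 T
      (1 * (\<xi> T - l) + (-1) * (\<xi> T - \<xi> t))"
    using at l
    by (intro has_KS_integral_linear has_KS_integral_step_after has_KS_integral_step_from is_playD(1)[OF play]) auto
  then show "has_KS_integral ?h \<xi> 0 T (\<xi> t - l)" by simp
qed

text \<open>
  If \<open>\<sigma> \<xi> t\<close> exceeded the bound \<open>c\<^sub>0\<close>, then after the last passage of \<open>\<sigma> \<xi>\<close> through a level strictly
  between \<open>c\<^sub>0\<close> and \<open>\<sigma> \<xi> t\<close> the difference \<open>\<sigma> (q - \<xi>)\<close> would stay below \<open>r\<close> by a fixed margin, so \<open>\<sigma> \<xi>\<close>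
  could not have increased since. The sign \<open>\<sigma>\<close> treats upward and downward motion together.
\<close>

lemma play_moves_only_at_threshold:
  assumes q: "regulated_on 0 T q" and play: "is_play T r q \<xi>"
    and st: "0 \<le> s" "s \<le> t" "t \<le> T" and \<sigma>: "\<sigma> = 1 \<or> \<sigma> = -1"
    and c: "\<And>x. s < x \<Longrightarrow> x \<le> t \<Longrightarrow> \<sigma> * q x - r \<le> c"
  shows "\<sigma> * \<xi> t \<le> max (\<sigma> * \<xi> s) c"
proof (rule ccontr)
  define c0 where "c0 = max (\<sigma> * \<xi> s) c"
  define f where "f = (\<lambda>x. \<sigma> * \<xi> x)"
  assume "\<not> \<sigma> * \<xi> t \<le> max (\<sigma> * \<xi> s) c"
  then have lt: "c0 < f t" unfolding c0_def f_def by (simp only: not_le)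
  \<comment> \<open>the margin \<open>e\<close> above \<open>c\<^sub>0\<close> is what makes the shifted test function admissible\<close>
  define d where "d = (c0 + f t) / 2"
  define e where "e = d - c0"
  have c0: "f s \<le> c0" "c \<le> c0" by (simp_all add: c0_def f_def)
  then have d: "f s \<le> d" "d < f t" "e > 0" "c + e \<le> d" using lt by (simp_all add: d_def e_def field_simps)
  have shift: "\<bar>q x - \<xi> x - (- (\<sigma> * e))\<bar> \<le> r" if "s < x" "x \<le> t" "d < f x" for x
    using that c[of x] d st is_playD(3)[OF play, of x] \<sigma> by (auto simp: f_def abs_le_iff)
  from st(2) d(1,2) show False
  proof (cases rule: last_passage_cases)
    case (attained a)
    have "0 \<le> - (\<sigma> * e) * (\<xi> t - \<xi> a)"
      by (rule play_increment_after[OF q play]) (use attained st shift in auto)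
    then have "0 \<le> e * (f a - f t)" by (simp add: f_def algebra_simps)
    then show False using d attained(3) by (simp add: zero_le_mult_iff)
  next
    case (jump a)
    obtain l where l: "(\<xi> \<longlongrightarrow> l) (at_left a)" using is_playD(2)[OF play, of a] jump st by auto
    have "0 \<le> - (\<sigma> * e) * (\<xi> t - l)"
      by (rule play_increment_from[OF q play _ _ _ _ l]) (use jump st shift in auto)
    then have "0 \<le> e * (\<sigma> * l - f t)" by (simp add: f_def algebra_simps)
    moreover have "\<sigma> * l \<le> d" by (rule jump(3)) (auto simp: f_def intro: tendsto_mult l)
    ultimately show False using d by (simp add: zero_le_mult_iff)
  qed
qed

text \<open>
  As long as \<open>\<xi> - \<eta>\<close> exceeds \<open>\<bar>r - r'\<bar>\<close> by a margin, \<open>q - \<xi>\<close> is away from \<open>r\<close> and \<open>q - \<eta>\<close> is away from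
  \<open>-r'\<close>; hence \<open>\<xi>\<close> cannot increase, \<open>\<eta>\<close> cannot decrease, and the difference cannot grow.
\<close>

lemma play_Lipschitz_threshold_le:
  assumes q: "regulated_on 0 T q" and play: "is_play T r q \<xi>" "is_play T r' q \<eta>"
    and t: "0 \<le> t" "t \<le> T" 
  shows "\<xi> t - \<eta> t \<le> \<bar>r - r'\<bar>"
proof (rule ccontr)
  define D where "D = \<bar>r - r'\<bar>"
  define f where "f = (\<lambda>x. \<xi> x - \<eta> x)"
  assume "\<not> \<xi> t - \<eta> t \<le> \<bar>r - r'\<bar>"
  then have lt: "D < f t" by (simp add: D_def f_def)
  define d where "d = (D + f t) / 2"
  define e where "e = d - D"
  have "f 0 \<le> D" using is_playD(4)[OF play(1)] is_playD(4)[OF play(2)] by (auto simp: f_def D_def max_def min_def abs_if)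
  then have d: "f 0 \<le> d" "d < f t" "e > 0" using lt by (auto simp: d_def e_def)
  have shift: "\<bar>q x - \<xi> x - (- e)\<bar> \<le> r \<and> \<bar>q x - \<eta> x - e\<bar> \<le> r'" if "0 \<le> x" "x \<le> t" "d < f x" for x
    using that d t is_playD(3)[OF play(1), of x] is_playD(3)[OF play(2), of x]
    by (auto simp: f_def e_def D_def abs_le_iff abs_if split: if_splits)
  from t(1) d(1,2) show False
  proof (cases rule: last_passage_cases)
    case (attained a)
    have "0 \<le> (- e) * (\<xi> t - \<xi> a)"
      by (rule play_increment_after[OF q play(1)]) (use attained t shift in auto)
    moreover have "0 \<le> e * (\<eta> t - \<eta> a)"
      by (rule play_increment_after[OF q play(2)]) (use attained t shift in auto)
    ultimately have "\<xi> t \<le> \<xi> a" "\<eta> a \<le> \<eta> t" using d(3) by (simp_all add: mult_le_0_iff zero_le_mult_iff)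
    then show False using d(2) attained(3) by (simp add: f_def)
  next
    case (jump a)
    obtain l where l: "(\<xi> \<longlongrightarrow> l) (at_left a)" using is_playD(2)[OF play(1), of a] jump t by auto
    obtain m where m: "(\<eta> \<longlongrightarrow> m) (at_left a)" using is_playD(2)[OF play(2), of a] jump t by auto
    have "0 \<le> (- e) * (\<xi> t - l)"
      by (rule play_increment_from[OF q play(1) _ _ _ _ l]) (use jump t shift in auto)
    moreover have "0 \<le> e * (\<eta> t - m)"
      by (rule play_increment_from[OF q play(2) _ _ _ _ m]) (use jump t shift in auto)
    moreover have "l - m \<le> d" by (rule jump(3)) (auto simp: f_def intro: tendsto_diff l m)
    ultimately have "\<xi> t \<le> l" "m \<le> \<eta> t" "l - m \<le> d"
      using d(3) by (simp_all add: mult_le_0_iff zero_le_mult_iff)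
    then show False using d(2) by (simp add: f_def)
  qed
qed

lemma play_Lipschitz_threshold:
  assumes "regulated_on 0 T q" "is_play T r q \<xi>" "is_play T r' q \<eta>" "0 \<le> t" "t \<le> T" 
  shows "\<bar>\<xi> t - \<eta> t\<bar> \<le> \<bar>r - r'\<bar>"
  using play_Lipschitz_threshold_le[OF assms] play_Lipschitz_threshold_le[OF assms(1,3,2,4,5)]
  by (simp add: abs_le_iff abs_minus_commute)

section \<open>The threshold rule\<close>

text \<open>
  The motion of the play without reference to an integral: \<open>\<xi>\<close> increases only as far as \<open>q - r\<close> pushes
  it and decreases only as far as \<open>q + r\<close> pushes it. Unlike the variational inequality this can be
  verified for an explicit function.
\<close>

definition threshold_rule :: "real \<Rightarrow> real \<Rightarrow> (real \<Rightarrow> real) \<Rightarrow> (real \<Rightarrow> real) \<Rightarrow> bool" where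
  "threshold_rule T r q \<xi> \<longleftrightarrow>
     (\<forall>t\<in>{0..T}. \<bar>q t - \<xi> t\<bar> \<le> r) \<and>
     (\<forall>\<sigma>\<in>{1,-1}. \<forall>s t c. 0 \<le> s \<and> s \<le> t \<and> t \<le> T \<and> (\<forall>x\<in>{s<..t}. \<sigma> * q x - r \<le> c) \<longrightarrow>
        \<sigma> * \<xi> t \<le> max (\<sigma> * \<xi> s) c)"

lemma threshold_ruleD:
  assumes "threshold_rule T r q \<xi>"
  shows "\<And>t. 0 \<le> t \<Longrightarrow> t \<le> T \<Longrightarrow> \<bar>q t - \<xi> t\<bar> \<le> r"
    and "\<And>s t c. 0 \<le> s \<Longrightarrow> s \<le> t \<Longrightarrow> t \<le> T \<Longrightarrow> (\<And>x. s < x \<Longrightarrow> x \<le> t \<Longrightarrow> q x - r \<le> c) \<Longrightarrow> \<xi> t \<le> max (\<xi> s) c"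
    and "\<And>s t c. 0 \<le> s \<Longrightarrow> s \<le> t \<Longrightarrow> t \<le> T \<Longrightarrow> (\<And>x. s < x \<Longrightarrow> x \<le> t \<Longrightarrow> c \<le> q x + r) \<Longrightarrow> min (\<xi> s) c \<le> \<xi> t"
proof -
  show "\<And>t. 0 \<le> t \<Longrightarrow> t \<le> T \<Longrightarrow> \<bar>q t - \<xi> t\<bar> \<le> r"
    using assms by (simp add: threshold_rule_def)
  fix s t c :: real assume st: "0 \<le> s" "s \<le> t" "t \<le> T"
  { assume "\<And>x. s < x \<Longrightarrow> x \<le> t \<Longrightarrow> q x - r \<le> c"
    then have "\<forall>x\<in>{s<..t}. 1 * q x - r \<le> c" by simp
    then have "1 * \<xi> t \<le> max (1 * \<xi> s) c"
      using assms st unfolding threshold_rule_def by blast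
    then show "\<xi> t \<le> max (\<xi> s) c" by simp }
  { assume "\<And>x. s < x \<Longrightarrow> x \<le> t \<Longrightarrow> c \<le> q x + r"
    then have "\<forall>x\<in>{s<..t}. (-1) * q x - r \<le> - c" by fastforce
    then have "(-1) * \<xi> t \<le> max ((-1) * \<xi> s) (- c)"
      using assms st unfolding threshold_rule_def by blast
    then show "min (\<xi> s) c \<le> \<xi> t" by (auto simp: min_def max_def split: if_splits) }
qed

text \<open>
  The function is \<open>\<xi> t = sup\<^sub>s min (h s) (inf\<^sub>[\<^sub>s\<^sub>,\<^sub>t\<^sub>] q + r)\<close>: the lower barrier lifts it to \<open>h s\<close> at some
  time \<open>s\<close>, after which only the upper barrier can have lowered it. Working with the set \<open>C t\<close> of all
  lower bounds of these minima avoids infima of a possibly unbounded \<open>q\<close>. Extending the time from \<open>s\<close> to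
  \<open>t\<close> adds the candidates with starting time in \<open>(s,t]\<close>, which are at most \<open>q - r\<close> there, and cuts the
  older ones at \<open>q + r\<close>; this is the rule.
\<close>

lemma threshold_rule_solution:
  assumes r: "r > 0"
  obtains \<xi> where "threshold_rule T r q \<xi>" "\<xi> 0 = max (q 0 - r) (min 0 (q 0 + r))"
proof -
  define x0 where "x0 = max (q 0 - r) (min 0 (q 0 + r))"
  define h where "h s = (if s = 0 then x0 else q s - r)" for s
  define C where "C t = {c. \<exists>s. 0 \<le> s \<and> s \<le> t \<and> c \<le> h s \<and> (\<forall>x. s \<le> x \<and> x \<le> t \<longrightarrow> c \<le> q x + r)}" for t
  define \<xi> where "\<xi> t = Sup (C t)" for t
  have x0: "q 0 - r \<le> x0" "x0 \<le> q 0 + r" using r by (auto simp: x0_def)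
  have low: "q t - r \<in> C t" if "0 \<le> t" for t
    using that r x0 by (auto simp: C_def h_def intro!: exI[of _ t])
  have up: "c \<le> q t + r" if "c \<in> C t" for c t using that by (auto simp: C_def)
  have bdd: "bdd_above (C t)" for t using up by (rule bdd_aboveI)
  have upper: "c \<le> \<xi> t" if "c \<in> C t" for c t unfolding \<xi>_def by (rule cSup_upper[OF that bdd])
  have least: "\<xi> t \<le> u" if "0 \<le> t" "\<And>c. c \<in> C t \<Longrightarrow> c \<le> u" for t u
    unfolding \<xi>_def by (rule cSup_least) (use that low[of t] in auto)
  have near: "\<bar>q t - \<xi> t\<bar> \<le> r" if "0 \<le> t" for t
  proof -
    have "q t - r \<le> \<xi> t" by (rule upper[OF low[OF that]])
    moreover have "\<xi> t \<le> q t + r" by (rule least[OF that up])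
    ultimately show ?thesis by linarith
  qed
  have "x0 \<le> q x + r" if "0 \<le> x \<and> x \<le> 0" for x
    using that x0(2) by (metis order_antisym)
  then have "x0 \<in> C 0" unfolding C_def h_def by (intro CollectI exI[of _ 0]) simp
  then have "x0 \<le> \<xi> 0" by (rule upper)
  moreover have "c \<le> x0" if c: "c \<in> C 0" for c
  proof -
    obtain s where s: "0 \<le> s" "s \<le> 0" "c \<le> h s" using c unfolding C_def by blast
    then have "s = 0" by linarith
    then show ?thesis using s(3) by (simp add: h_def)
  qed
  then have "\<xi> 0 \<le> x0" by (rule least[OF order_refl])
  ultimately have init: "\<xi> 0 = x0" by (rule antisym[rotated])
  have rise: "\<xi> t \<le> max (\<xi> s) c" if st: "0 \<le> s" "s \<le> t" and c: "\<forall>x\<in>{s<..t}. q x - r \<le> c" for s t c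
  proof (rule least)
    fix b assume "b \<in> C t"
    then obtain p where p: "0 \<le> p" "p \<le> t" "b \<le> h p" "\<And>x. p \<le> x \<Longrightarrow> x \<le> t \<Longrightarrow> b \<le> q x + r"
      by (auto simp: C_def)
    show "b \<le> max (\<xi> s) c"
    proof (cases "p \<le> s")
      case True
      then have "b \<in> C s" using p st by (auto simp: C_def)
      then show ?thesis using upper[of b s] by simp
    next
      case False
      then have "h p \<le> c" using c p st by (auto simp: h_def)
      then show ?thesis using p by simp
    qed
  qed (use st in simp)
  have fall: "min (\<xi> s) c \<le> \<xi> t" if st: "0 \<le> s" "s \<le> t" and c: "\<forall>x\<in>{s<..t}. c \<le> q x + r" for s t c
  proof (rule ccontr)
    assume "\<not> min (\<xi> s) c \<le> \<xi> t"
    then have lt: "\<xi> t < Sup (C s)" "\<xi> t < c" by (auto simp: \<xi>_def)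
    have "C s \<noteq> {}" using low[OF st(1)] by blast
    then obtain b where b: "b \<in> C s" "\<xi> t < b" using less_cSupD[OF _ lt(1)] by blast
    then obtain p where p: "0 \<le> p" "p \<le> s" "b \<le> h p" "\<And>x. p \<le> x \<Longrightarrow> x \<le> s \<Longrightarrow> b \<le> q x + r"
      by (auto simp: C_def)
    have "min b c \<le> q x + r" if "p \<le> x" "x \<le> t" for x
      using p(4)[of x] c that by (cases "x \<le> s") (force simp: min_le_iff_disj)+
    then have "min b c \<in> C t" using p st by (auto simp: C_def min_le_iff_disj intro!: exI[of _ p])
    from upper[OF this] b lt show False by auto
  qed
  have "threshold_rule T r q \<xi>"
    unfolding threshold_rule_def
  proof (intro conjI ballI allI impI)
    show "\<bar>q t - \<xi> t\<bar> \<le> r" if "t \<in> {0..T}" for t using near that by simp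
    fix \<sigma> s t c :: real
    assume \<sigma>: "\<sigma> \<in> {1,-1}" and *: "0 \<le> s \<and> s \<le> t \<and> t \<le> T \<and> (\<forall>x\<in>{s<..t}. \<sigma> * q x - r \<le> c)"
    show "\<sigma> * \<xi> t \<le> max (\<sigma> * \<xi> s) c"
    proof (cases "\<sigma> = 1")
      case True then show ?thesis using rise[of s t c] * by simp
    next
      case False
      then have "\<sigma> = -1" using \<sigma> by simp
      moreover from this have "\<forall>x\<in>{s<..t}. - c \<le> q x + r" using * by fastforce
      ultimately show ?thesis using fall[of s t "- c"] * by (auto simp: min_def max_def split: if_splits)
    qed
  qed
  then show thesis using that init by (simp add: x0_def)
qed

text \<open>
  Both barriers are within \<open>e\<close> of their position at time \<open>s\<close>, when \<open>\<xi> s\<close> was between them.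
\<close>

lemma threshold_rule_increment:
  assumes rule: "threshold_rule T r q \<xi>" and st: "0 \<le> s" "s \<le> t" "t \<le> T"
    and e: "e \<ge> 0" "\<And>x. s < x \<Longrightarrow> x \<le> t \<Longrightarrow> \<bar>q x - q s\<bar> \<le> e"
  shows "\<bar>\<xi> t - \<xi> s\<bar> \<le> e"
proof -
  have "\<xi> t \<le> max (\<xi> s) (q s + e - r)"
    by (rule threshold_ruleD(2)[OF rule st]) (use e(2) in fastforce)
  moreover have "min (\<xi> s) (q s - e + r) \<le> \<xi> t"
    by (rule threshold_ruleD(3)[OF rule st]) (use e(2) in fastforce)
  ultimately show ?thesis using threshold_ruleD(1)[OF rule, of s] st e(1) by (auto simp: abs_le_iff)
qed

lemma threshold_rule_G_R:
  assumes rule: "threshold_rule T r q \<xi>" and q: "q \<in> G_R T"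
  shows "\<xi> \<in> G_R T"
proof -
  have right: "(\<xi> \<longlongrightarrow> \<xi> t) (at_right t)" if t: "t \<in> {0..<T}" for t
    unfolding tendsto_at_right_real_iff
  proof (intro allI impI)
    fix e :: real assume e: "e > 0"
    have "(q \<longlongrightarrow> q t) (at_right t)" using G_RD(1)[OF q] t by simp
    then obtain d where d: "d > t" "\<And>y. t < y \<Longrightarrow> y < d \<Longrightarrow> \<bar>q y - q t\<bar> < e/2"
      using e unfolding tendsto_at_right_real_iff by (metis half_gt_zero)
    have "\<bar>\<xi> y - \<xi> t\<bar> < e" if "t < y" "y < min d T" for y
    proof -
      have "\<bar>\<xi> y - \<xi> t\<bar> \<le> e/2"
        by (rule threshold_rule_increment[OF rule]) (use that t e d(2) in \<open>auto intro: less_imp_le\<close>)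
      then show ?thesis using e by simp
    qed
    then show "\<exists>d>t. \<forall>y. t < y \<and> y < d \<longrightarrow> \<bar>\<xi> y - \<xi> t\<bar> < e"
      using d t by (intro exI[of _ "min d T"]) auto
  qed
  have left: "\<exists>l. (\<xi> \<longlongrightarrow> l) (at_left t)" if t: "t \<in> {0<..T}" for t
  proof (rule left_limit_of_Cauchy)
    fix e :: real assume e: "e > 0"
    obtain p where "(q \<longlongrightarrow> p) (at_left t)" using G_RD(2)[OF q, of t] t by auto
    then obtain d where d: "d < t" "\<And>y. d < y \<Longrightarrow> y < t \<Longrightarrow> \<bar>q y - p\<bar> < e/2"
      using e unfolding tendsto_at_left_real_iff by (metis half_gt_zero)
    have "\<bar>\<xi> y - \<xi> x\<bar> \<le> e" if xy: "max d 0 < x \<and> x < y \<and> y < t" for x y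
    proof (rule threshold_rule_increment[OF rule])
      show "\<bar>q u - q x\<bar> \<le> e" if "x < u" "u \<le> y" for u
      proof -
        have "\<bar>q u - p\<bar> < e/2" "\<bar>q x - p\<bar> < e/2" using d(2)[of u] d(2)[of x] that xy by auto
        then show ?thesis by linarith
      qed
    qed (use xy t e in auto)
    then show "\<exists>d<t. \<forall>x y. d < x \<and> x < y \<and> y < t \<longrightarrow> \<bar>\<xi> y - \<xi> x\<bar> \<le> e"
      using d t by (intro exI[of _ "max d 0"]) auto
  qed
  show ?thesis using left right unfolding G_R_def regulated_on_def right_continuous_on_def by blast
qed

section \<open>Bounded variation\<close>

text \<open>
  A function \<open>V\<close> whose increments dominate those of \<open>g\<close>, such as the variation function of \<open>g\<close>. Since
  \<open>V\<close> telescopes, it controls sums over divisions without any manipulation of divisions.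
\<close>

definition variation_majorant :: "real \<Rightarrow> real \<Rightarrow> (real \<Rightarrow> real) \<Rightarrow> (real \<Rightarrow> real) \<Rightarrow> bool" where
  "variation_majorant a b g V \<longleftrightarrow> (\<forall>x y. a \<le> x \<and> x \<le> y \<and> y \<le> b \<longrightarrow> \<bar>g y - g x\<bar> \<le> V y - V x)"

lemma variation_majorantD:
  "variation_majorant a b g V \<Longrightarrow> a \<le> x \<Longrightarrow> x \<le> y \<Longrightarrow> y \<le> b \<Longrightarrow> \<bar>g y - g x\<bar> \<le> V y - V x"
  by (simp add: variation_majorant_def)

text \<open>
  Tagging each cell with its left end turns a division into a tagged division, along which the
  increments of \<open>V\<close> telescope.
\<close>

lemma variation_majorant_bounded:
  assumes ab: "a \<le> b" and V: "variation_majorant a b g V"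
  shows "bounded_variation_on a b g"
  unfolding bounded_variation_on_def
proof (intro exI[of _ "V b - V a"] allI impI)
  fix D assume D: "D division_of {a..b}"
  define \<D> where "\<D> = (\<lambda>K. (Inf K, K)) ` D"
  have cell: "\<exists>c d. K = {c..d} \<and> a \<le> c \<and> c \<le> d \<and> d \<le> b" if K: "K \<in> D" for K
  proof -
    obtain c d where "K = cbox c d" using division_ofD(4)[OF D K] by blast
    moreover have "K \<noteq> {}" "K \<subseteq> {a..b}" using division_ofD(2,3)[OF D K] by auto
    ultimately show ?thesis by auto
  qed
  have "\<D> tagged_division_of {a..b}"
    unfolding tagged_division_of
  proof (intro conjI allI impI)
    show "finite \<D>" using D by (auto simp: \<D>_def)
    have "{K. \<exists>x. (x, K) \<in> \<D>} = D" by (auto simp: \<D>_def)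
    then show "\<Union>{K. \<exists>x. (x, K) \<in> \<D>} = {a..b}" using division_ofD(6)[OF D] by simp
    fix x K assume xK: "(x, K) \<in> \<D>"
    then obtain c d where "K = {c..d}" "a \<le> c" "c \<le> d" "d \<le> b" "x = Inf K"
      using cell by (force simp: \<D>_def)
    then show "x \<in> K" "K \<subseteq> {a..b}" "\<exists>a b. K = cbox a b" by auto
  next
    fix x K y K' assume yK: "(x, K) \<in> \<D> \<and> (y, K') \<in> \<D> \<and> (x, K) \<noteq> (y, K')"
    then have "K \<in> D" "K' \<in> D" "K \<noteq> K'" by (auto simp: \<D>_def)
    then show "interior K \<inter> interior K' = {}" using division_ofD(5)[OF D] by blast
  qed
  then have tel: "(\<Sum>(x,K)\<in>\<D>. V (Sup K) - V (Inf K)) = V b - V a"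
    using additive_tagged_division_1[OF ab] by blast
  have "(\<Sum>K\<in>D. \<bar>g (Sup K) - g (Inf K)\<bar>) \<le> (\<Sum>K\<in>D. V (Sup K) - V (Inf K))"
  proof (rule sum_mono)
    fix K assume "K \<in> D"
    from cell[OF this] show "\<bar>g (Sup K) - g (Inf K)\<bar> \<le> V (Sup K) - V (Inf K)"
      using variation_majorantD[OF V] by auto
  qed
  also have "\<dots> = (\<Sum>(x,K)\<in>\<D>. V (Sup K) - V (Inf K))"
    unfolding \<D>_def by (subst sum.reindex) (auto simp: inj_on_def)
  finally show "(\<Sum>K\<in>D. \<bar>g (Sup K) - g (Inf K)\<bar>) \<le> V b - V a" using tel by simp
qed

definition glue :: "real \<Rightarrow> (real \<Rightarrow> real) \<Rightarrow> (real \<Rightarrow> real) \<Rightarrow> real \<Rightarrow> real" where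
  "glue y F G t = (if t \<le> y then F t else F y + G t - G y)"

lemma variation_majorant_glue:
  assumes "variation_majorant x y g V" "variation_majorant y z g V'"
  shows "variation_majorant x z g (glue y V V')"
  unfolding variation_majorant_def
proof (intro allI impI)
  fix s t assume st: "x \<le> s \<and> s \<le> t \<and> t \<le> z"
  consider "t \<le> y" | "y \<le> s" "y < t" | "s < y" "y < t" by linarith
  then show "\<bar>g t - g s\<bar> \<le> glue y V V' t - glue y V V' s"
  proof cases
    case 1
    then show ?thesis using st variation_majorantD[OF assms(1), of s t] by (auto simp: glue_def)
  next
    case 2
    then show ?thesis using st variation_majorantD[OF assms(2), of s t] by (auto simp: glue_def)
  next
    case 3
    then show ?thesis
      using st variation_majorantD[OF assms(1), of s y] variation_majorantD[OF assms(2), of y t]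
      by (auto simp: glue_def)
  qed
qed

text \<open>
  If \<open>q - r \<le> p \<le> q + r\<close> throughout, upward motion never passes \<open>p\<close> and downward motion never passes
  \<open>p\<close> either. So \<open>\<xi>\<close> can only rise if it starts below \<open>p\<close> and only fall if it starts above.
\<close>

lemma threshold_rule_monotone_window:
  assumes rule: "threshold_rule T r q \<xi>" and cd: "0 \<le> c" "d \<le> T"
    and window: "\<And>x. c < x \<Longrightarrow> x < d \<Longrightarrow> \<bar>q x - p\<bar> \<le> r"
  obtains \<kappa> :: real where "\<bar>\<kappa>\<bar> = 1"
    "\<And>x y. c \<le> x \<Longrightarrow> x \<le> y \<Longrightarrow> y < d \<Longrightarrow> \<bar>\<xi> y - \<xi> x\<bar> \<le> \<kappa> * \<xi> y - \<kappa> * \<xi> x"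
proof -
  have win: "q x - r \<le> p" "p \<le> q x + r" if "c < x" "x < d" for x
    using window[OF that] by (simp_all add: abs_le_iff)
  have up: "\<xi> y \<le> max (\<xi> x) p" if "c \<le> x" "x \<le> y" "y < d" for x y
    by (rule threshold_ruleD(2)[OF rule]) (use that cd win in auto)
  have down: "min (\<xi> x) p \<le> \<xi> y" if "c \<le> x" "x \<le> y" "y < d" for x y
    by (rule threshold_ruleD(3)[OF rule]) (use that cd win in auto)
  show thesis
  proof (cases "\<xi> c \<le> p")
    case True
    have "\<bar>\<xi> y - \<xi> x\<bar> \<le> 1 * \<xi> y - 1 * \<xi> x" if "c \<le> x" "x \<le> y" "y < d" for x y
      using up[of c x] down[of x y] that True by auto
    then show thesis using that[of 1] by auto
  next
    case False
    have "\<bar>\<xi> y - \<xi> x\<bar> \<le> (-1) * \<xi> y - (-1) * \<xi> x" if "c \<le> x" "x \<le> y" "y < d" for x y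
      using down[of c x] up[of x y] that False by auto
    then show thesis using that[of "-1"] by auto
  qed
qed

text \<open>
  Near each point \<open>q\<close> stays within \<open>r\<close> of a one-sided limit \<open>p\<close>, so \<open>\<xi>\<close> is monotone there and \<open>\<plusminus>\<xi>\<close> is a
  majorant; only the jump at the right end of an interval needs an additional jump of \<open>V\<close>.
\<close>

lemma threshold_rule_variation:
  assumes rule: "threshold_rule T r q \<xi>" and q: "q \<in> G_R T" and r: "r > 0" and T: "0 \<le> T"
  shows "\<exists>V. variation_majorant 0 T \<xi> V"
  using T
proof (rule interval_concat_induct)
  show "\<exists>V. variation_majorant x x \<xi> V" for x
  proof -
    have "variation_majorant x x \<xi> (\<lambda>_. 0)"
      unfolding variation_majorant_def
    proof (intro allI impI)
      fix s t assume "x \<le> s \<and> s \<le> t \<and> t \<le> x"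
      then have "s = t" by linarith
      then show "\<bar>\<xi> t - \<xi> s\<bar> \<le> 0 - 0" by simp
    qed
    then show ?thesis by blast
  qed
  show "\<exists>V. variation_majorant x z \<xi> V"
    if "\<exists>V. variation_majorant x y \<xi> V" "\<exists>V. variation_majorant y z \<xi> V" for x y z
    using that variation_majorant_glue by blast
  show "\<exists>y. x < y \<and> y \<le> T \<and> (\<exists>V. variation_majorant x y \<xi> V)" if x: "0 \<le> x" "x < T" for x
  proof -
    have "(q \<longlongrightarrow> q x) (at_right x)" using G_RD(1)[OF q] x by simp
    then obtain d where d: "d > x" "\<And>y. x < y \<Longrightarrow> y < d \<Longrightarrow> \<bar>q y - q x\<bar> < r"
      using r unfolding tendsto_at_right_real_iff by blast
    define e where "e = min d T"
    have e: "x < e" "e \<le> T" "\<And>y. x < y \<Longrightarrow> y < e \<Longrightarrow> \<bar>q y - q x\<bar> \<le> r"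
      using d x by (auto simp: e_def less_imp_le)
    obtain \<kappa> where \<kappa>: "\<And>s t. x \<le> s \<Longrightarrow> s \<le> t \<Longrightarrow> t < e \<Longrightarrow> \<bar>\<xi> t - \<xi> s\<bar> \<le> \<kappa> * \<xi> t - \<kappa> * \<xi> s"
      using threshold_rule_monotone_window[OF rule x(1) e(2,3)] by metis
    \<comment> \<open>a point strictly inside the window, which does not contain its right end\<close>
    have "variation_majorant x ((x + e) / 2) \<xi> (\<lambda>t. \<kappa> * \<xi> t)"
      using \<kappa> e(1) by (auto simp: variation_majorant_def)
    then show ?thesis using e by (intro exI[of _ "(x + e) / 2"]) auto
  qed
  show "\<exists>d<x. 0 \<le> d \<and> (\<forall>y. d < y \<and> y < x \<longrightarrow> (\<exists>V. variation_majorant y x \<xi> V))"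
    if x: "0 < x" "x \<le> T" for x
  proof -
    obtain p where "(q \<longlongrightarrow> p) (at_left x)" using G_RD(2)[OF q, of x] x by auto
    then obtain d where d: "d < x" "\<And>y. d < y \<Longrightarrow> y < x \<Longrightarrow> \<bar>q y - p\<bar> < r"
      using r unfolding tendsto_at_left_real_iff by blast
    have "\<exists>V. variation_majorant y x \<xi> V" if y: "max d 0 < y \<and> y < x" for y
    proof -
      have y': "0 \<le> y" "\<And>t. y < t \<Longrightarrow> t < x \<Longrightarrow> \<bar>q t - p\<bar> \<le> r"
        using y d by (auto simp: less_imp_le)
      obtain \<kappa> where \<kappa>: "\<bar>\<kappa>\<bar> = 1" "\<And>s t. y \<le> s \<Longrightarrow> s \<le> t \<Longrightarrow> t < x \<Longrightarrow> \<bar>\<xi> t - \<xi> s\<bar> \<le> \<kappa> * \<xi> t - \<kappa> * \<xi> s"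
        using threshold_rule_monotone_window[OF rule y'(1) x(2) y'(2)] by metis
      define K where "K = \<bar>p\<bar> + 2 * r"
      have K: "\<bar>\<xi> t\<bar> \<le> K" if "y \<le> t" "t < x" for t
        using d(2)[of t] threshold_ruleD(1)[OF rule, of t] that y x by (auto simp: K_def)
      \<comment> \<open>at \<open>x\<close> the majorant jumps by enough to cover any jump of \<open>\<xi>\<close>\<close>
      define V where "V t = (if t < x then \<kappa> * \<xi> t else 2 * K + \<bar>\<xi> x\<bar>)" for t
      have "\<bar>\<xi> t - \<xi> s\<bar> \<le> V t - V s" if st: "y \<le> s" "s \<le> t" "t \<le> x" for s t
      proof (cases "t < x")
        case True
        then show ?thesis using \<kappa>(2)[of s t] st by (simp add: V_def)
      next
        case False
        then have "t = x" using st by simp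
        moreover have "\<bar>\<kappa> * \<xi> s\<bar> = \<bar>\<xi> s\<bar>" using \<kappa>(1) by (simp add: abs_mult)
        ultimately show ?thesis using K[of s] st by (cases "s = x") (auto simp: V_def)
      qed
      then show ?thesis by (intro exI[of _ V]) (simp add: variation_majorant_def)
    qed
    then show ?thesis using d x by (intro exI[of _ "max d 0"]) auto
  qed
qed

section \<open>Existence of the play\<close>

lemma KS_primitive_glue:
  assumes xyz: "x < y" "y < z"
    and 1: "KS_primitive f g x y F W" and 2: "KS_primitive f g y z F' W'"
  shows "KS_primitive f g x z (glue y F F') (glue y W W')"
proof (rule KS_primitiveI)
  fix t assume t: "x \<le> t" "t \<le> z"
  have s1: "glue y H H' u = H u" if "u \<le> y" for H H' u using that by (simp add: glue_def)
  have s2: "glue y H H' u = H y + H' u - H' y" if "y \<le> u" for H H' u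
    using that by (auto simp: glue_def)
  let ?R = "\<lambda>\<delta>. \<forall>u. t < u \<and> u < t + \<delta> \<and> u \<le> z \<longrightarrow>
      \<bar>f t * (g u - g t) - (glue y F F' u - glue y F F' t)\<bar> \<le> glue y W W' u - glue y W W' t"
  let ?L = "\<lambda>\<delta>. \<forall>u. t - \<delta> < u \<and> u < t \<and> x \<le> u \<longrightarrow>
      \<bar>f t * (g t - g u) - (glue y F F' t - glue y F F' u)\<bar> \<le> glue y W W' t - glue y W W' u"
  have R: "\<exists>\<delta>>0. ?R \<delta>"
  proof (cases "t < y")
    case True
    then obtain \<delta> where "\<delta> > 0"
      "\<And>u. t < u \<Longrightarrow> u < t + \<delta> \<Longrightarrow> u \<le> y \<Longrightarrow> \<bar>f t * (g u - g t) - (F u - F t)\<bar> \<le> W u - W t"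
      using KS_primitiveE[OF 1, of t] t by (metis less_imp_le)
    then show ?thesis using True by (intro exI[of _ "min \<delta> (y - t)"]) (auto simp: s1)
  next
    case False
    then obtain \<delta> where "\<delta> > 0"
      "\<And>u. t < u \<Longrightarrow> u < t + \<delta> \<Longrightarrow> u \<le> z \<Longrightarrow> \<bar>f t * (g u - g t) - (F' u - F' t)\<bar> \<le> W' u - W' t"
      using KS_primitiveE[OF 2, of t] t by (metis not_less)
    then show ?thesis using False by (intro exI[of _ \<delta>]) (auto simp: s2)
  qed
  have L: "\<exists>\<delta>>0. ?L \<delta>"
  proof (cases "t \<le> y")
    case True
    then obtain \<delta> where "\<delta> > 0"
      "\<And>u. t - \<delta> < u \<Longrightarrow> u < t \<Longrightarrow> x \<le> u \<Longrightarrow> \<bar>f t * (g t - g u) - (F t - F u)\<bar> \<le> W t - W u"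
      using KS_primitiveE[OF 1, of t] t by metis
    then show ?thesis using True by (intro exI[of _ \<delta>]) (auto simp: s1)
  next
    case False
    then obtain \<delta> where "\<delta> > 0"
      "\<And>u. t - \<delta> < u \<Longrightarrow> u < t \<Longrightarrow> y \<le> u \<Longrightarrow> \<bar>f t * (g t - g u) - (F' t - F' u)\<bar> \<le> W' t - W' u"
      using KS_primitiveE[OF 2, of t] t by (metis not_le less_imp_le)
    then show ?thesis using False by (intro exI[of _ "min \<delta> (t - y)"]) (auto simp: s2)
  qed
  from R L obtain \<delta>1 \<delta>2 where "\<delta>1 > 0" "?R \<delta>1" "\<delta>2 > 0" "?L \<delta>2" by blast
  then show "\<exists>\<delta>>0. ?R \<delta> \<and> ?L \<delta>" by (intro exI[of _ "min \<delta>1 \<delta>2"]) force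
qed

text \<open>
  To the right of \<open>c\<close> the integrand is within \<open>\<epsilon>\<close> of \<open>l\<close>, so \<open>l g\<close> is an approximate primitive with error
  \<open>\<epsilon> V\<close>. The value \<open>f c\<close> may be far from \<open>l\<close>, but it only multiplies increments of \<open>g\<close> that start at \<open>c\<close>,
  and these are small by right continuity.
\<close>

lemma KS_primitive_right_piece:
  assumes V: "variation_majorant c d g V" and g: "(g \<longlongrightarrow> g c) (at_right c)"
    and f: "\<And>x. c < x \<Longrightarrow> x \<le> d \<Longrightarrow> \<bar>f x - l\<bar> \<le> \<epsilon>" and \<eta>: "\<eta> > 0"
  shows "KS_primitive f g c d (\<lambda>x. l * g x) (\<lambda>x. \<epsilon> * V x + (if c < x then \<eta> else 0))"
proof (rule KS_primitiveI)
  fix x assume x: "c \<le> x" "x \<le> d"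
  have inner: "\<bar>f x * (g v - g u) - (l * g v - l * g u)\<bar> \<le> \<epsilon> * V v - \<epsilon> * V u"
    if "c < x" "c \<le> u" "u \<le> v" "v \<le> d" for u v
  proof -
    have "\<bar>(f x - l) * (g v - g u)\<bar> \<le> \<epsilon> * (V v - V u)"
      unfolding abs_mult using f[of x] x that variation_majorantD[OF V, of u v]
      by (intro mult_mono) auto
    then show ?thesis by (simp add: algebra_simps)
  qed
  show "\<exists>\<delta>>0. (\<forall>y. x < y \<and> y < x + \<delta> \<and> y \<le> d \<longrightarrow> \<bar>f x * (g y - g x) - (l * g y - l * g x)\<bar> \<le>
            \<epsilon> * V y + (if c < y then \<eta> else 0) - (\<epsilon> * V x + (if c < x then \<eta> else 0))) \<and>
      (\<forall>y. x - \<delta> < y \<and> y < x \<and> c \<le> y \<longrightarrow> \<bar>f x * (g x - g y) - (l * g x - l * g y)\<bar> \<le>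
            \<epsilon> * V x + (if c < x then \<eta> else 0) - (\<epsilon> * V y + (if c < y then \<eta> else 0)))"
  proof (cases "c < x")
    case True
    show ?thesis
    proof (intro exI[of _ "x - c"] conjI allI impI)
      fix y assume "x < y \<and> y < x + (x - c) \<and> y \<le> d"
      then show "\<bar>f x * (g y - g x) - (l * g y - l * g x)\<bar> \<le>
            \<epsilon> * V y + (if c < y then \<eta> else 0) - (\<epsilon> * V x + (if c < x then \<eta> else 0))"
        using inner[of x y] True by simp
    next
      fix y assume "x - (x - c) < y \<and> y < x \<and> c \<le> y"
      then show "\<bar>f x * (g x - g y) - (l * g x - l * g y)\<bar> \<le>
            \<epsilon> * V x + (if c < x then \<eta> else 0) - (\<epsilon> * V y + (if c < y then \<eta> else 0))"
        using inner[of y x] True x by simp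
    qed (use True in simp)
  next
    case False
    then have xc: "x = c" using x by simp
    define M where "M = \<bar>f c - l\<bar> + 1"
    have M: "M > 0" by (simp add: M_def)
    have "\<eta> / M > 0" using \<eta> M by simp
    then obtain b where b: "b > c" "\<And>y. c < y \<Longrightarrow> y < b \<Longrightarrow> \<bar>g y - g c\<bar> < \<eta> / M"
      using g unfolding tendsto_at_right_real_iff by blast
    show ?thesis
    proof (intro exI[of _ "b - c"] conjI allI impI)
      fix y assume y: "x < y \<and> y < x + (b - c) \<and> y \<le> d"
      have "\<bar>(f c - l) * (g y - g c)\<bar> \<le> M * (\<eta> / M)"
        unfolding abs_mult using b(2)[of y] y xc M by (intro mult_mono) (auto simp: M_def)
      then have "\<bar>f c * (g y - g c) - (l * g y - l * g c)\<bar> \<le> \<eta>" using M by (simp add: algebra_simps)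
      moreover have "0 \<le> \<epsilon> * (V y - V c)"
        using f[of y] y xc variation_majorantD[OF V, of c y] by (intro mult_nonneg_nonneg) auto
      ultimately show "\<bar>f x * (g y - g x) - (l * g y - l * g x)\<bar> \<le>
            \<epsilon> * V y + (if c < y then \<eta> else 0) - (\<epsilon> * V x + (if c < x then \<eta> else 0))"
        using y xc by (simp add: algebra_simps)
    qed (use b xc in auto)
  qed
qed

text \<open>
  The counterpart on the left of \<open>d\<close>, where \<open>g\<close> may jump: the jump \<open>g d - m\<close> is weighted with the value
  of \<open>f\<close> at \<open>d\<close> itself.
\<close>

lemma KS_primitive_left_piece:
  assumes V: "variation_majorant c d g V" and g: "(g \<longlongrightarrow> m) (at_left d)"
    and f: "\<And>x. c \<le> x \<Longrightarrow> x < d \<Longrightarrow> \<bar>f x - l\<bar> \<le> \<epsilon>" and \<eta>: "\<eta> > 0"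
  shows "KS_primitive f g c d (\<lambda>x. if x < d then l * g x else l * m + f d * (g d - m))
    (\<lambda>x. \<epsilon> * V x + (if x < d then 0 else \<eta>))"
    (is "KS_primitive f g c d ?F ?W")
proof (rule KS_primitiveI)
  fix x assume x: "c \<le> x" "x \<le> d"
  have inner: "\<bar>f x * (g v - g u) - (l * g v - l * g u)\<bar> \<le> \<epsilon> * V v - \<epsilon> * V u"
    if "x < d" "c \<le> u" "u \<le> v" "v \<le> d" for u v
  proof -
    have "\<bar>(f x - l) * (g v - g u)\<bar> \<le> \<epsilon> * (V v - V u)"
      unfolding abs_mult using f[of x] x that variation_majorantD[OF V, of u v]
      by (intro mult_mono) auto
    then show ?thesis by (simp add: algebra_simps)
  qed
  show "\<exists>\<delta>>0. (\<forall>y. x < y \<and> y < x + \<delta> \<and> y \<le> d \<longrightarrow> \<bar>f x * (g y - g x) - (?F y - ?F x)\<bar> \<le> ?W y - ?W x) \<and>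
      (\<forall>y. x - \<delta> < y \<and> y < x \<and> c \<le> y \<longrightarrow> \<bar>f x * (g x - g y) - (?F x - ?F y)\<bar> \<le> ?W x - ?W y)"
  proof (cases "x < d")
    case True
    show ?thesis
    proof (intro exI[of _ "d - x"] conjI allI impI)
      fix y assume "x < y \<and> y < x + (d - x) \<and> y \<le> d"
      then show "\<bar>f x * (g y - g x) - (?F y - ?F x)\<bar> \<le> ?W y - ?W x"
        using inner[of x y] True x by simp
    next
      fix y assume "x - (d - x) < y \<and> y < x \<and> c \<le> y"
      then show "\<bar>f x * (g x - g y) - (?F x - ?F y)\<bar> \<le> ?W x - ?W y"
        using inner[of y x] True x by simp
    qed (use True in simp)
  next
    case False
    then have xd: "x = d" using x by simp
    define M where "M = \<bar>f d - l\<bar> + 1"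
    have M: "M > 0" by (simp add: M_def)
    have "\<eta> / M > 0" using \<eta> M by simp
    then obtain b where b: "b < d" "\<And>y. b < y \<Longrightarrow> y < d \<Longrightarrow> \<bar>g y - m\<bar> < \<eta> / M"
      using g unfolding tendsto_at_left_real_iff by blast
    show ?thesis
    proof (intro exI[of _ "d - b"] conjI allI impI)
      fix y assume y: "x - (d - b) < y \<and> y < x \<and> c \<le> y"
      have "\<bar>(f d - l) * (m - g y)\<bar> \<le> M * (\<eta> / M)"
        unfolding abs_mult using b(2)[of y] y xd M by (intro mult_mono) (auto simp: M_def)
      then have "\<bar>f d * (g d - g y) - (l * m + f d * (g d - m) - l * g y)\<bar> \<le> \<eta>"
        using M by (simp add: algebra_simps)
      moreover have "0 \<le> \<epsilon> * (V d - V y)"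
        using f[of y] y xd x variation_majorantD[OF V, of y d] by (intro mult_nonneg_nonneg) auto
      ultimately show "\<bar>f x * (g x - g y) - (?F x - ?F y)\<bar> \<le> ?W x - ?W y"
        using y xd by (simp add: algebra_simps)
    qed (use b xd in auto)
  qed
qed

text \<open>
  If \<open>\<xi>\<close> increases from \<open>s\<close> to \<open>t\<close>, it ends at most at the supremum of \<open>q - r\<close>, hence \<open>p - \<xi> \<ge> r - \<epsilon>\<close> at
  both ends, and \<open>p - \<xi> - \<zeta> \<ge> -\<epsilon>\<close>. A decrease is symmetric. This is the integrand of the variational
  inequality times the increment of the integrator.
\<close>

lemma threshold_rule_dissipation:
  assumes rule: "threshold_rule T r q \<xi>" and st: "0 \<le> s" "s \<le> t" "t \<le> T"
    and p: "\<And>x. s < x \<Longrightarrow> x \<le> t \<Longrightarrow> \<bar>q x - p\<bar> \<le> \<epsilon>" and \<zeta>: "\<bar>\<zeta>\<bar> \<le> r"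
    and y: "y = \<xi> s \<or> y = \<xi> t"
  shows "- \<epsilon> * \<bar>\<xi> t - \<xi> s\<bar> \<le> (p - y - \<zeta>) * (\<xi> t - \<xi> s)"
proof -
  have "\<xi> t \<le> max (\<xi> s) (p + \<epsilon> - r)"
    by (rule threshold_ruleD(2)[OF rule st]) (use p in fastforce)
  have "min (\<xi> s) (p - \<epsilon> + r) \<le> \<xi> t"
    by (rule threshold_ruleD(3)[OF rule st]) (use p in fastforce)
  consider "\<xi> s < \<xi> t" | "\<xi> t < \<xi> s" | "\<xi> s = \<xi> t" by linarith
  then show ?thesis
  proof cases
    case 1
    then have "- \<epsilon> \<le> p - y - \<zeta>" using \<open>\<xi> t \<le> max (\<xi> s) (p + \<epsilon> - r)\<close> y \<zeta> by auto
    then have "- \<epsilon> * (\<xi> t - \<xi> s) \<le> (p - y - \<zeta>) * (\<xi> t - \<xi> s)" using 1 by (intro mult_right_mono) auto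
    then show ?thesis using 1 by simp
  next
    case 2
    then have "p - y - \<zeta> \<le> \<epsilon>" using \<open>min (\<xi> s) (p - \<epsilon> + r) \<le> \<xi> t\<close> y \<zeta> by auto
    then have "(p - y - \<zeta>) * (\<xi> s - \<xi> t) \<le> \<epsilon> * (\<xi> s - \<xi> t)" using 2 by (intro mult_right_mono) auto
    then show ?thesis using 2 by (simp add: algebra_simps)
  qed auto
qed

text \<open>
  A jump of \<open>\<xi>\<close> at \<open>t\<close> cannot be caused by the values of \<open>q\<close> before \<open>t\<close>, whose barriers \<open>\<xi>\<close> already
  respects in the limit, so it ends on the barrier belonging to \<open>q t\<close>.
\<close>

lemma threshold_rule_jump:
  assumes rule: "threshold_rule T r q \<xi>" and t: "0 < t" "t \<le> T"
    and q: "(q \<longlongrightarrow> p) (at_left t)" and \<xi>: "(\<xi> \<longlongrightarrow> m) (at_left t)" and \<zeta>: "\<bar>\<zeta>\<bar> \<le> r"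
  shows "0 \<le> (q t - \<xi> t - \<zeta>) * (\<xi> t - m)"
proof -
  have pm: "p - r \<le> m + e \<and> m - e \<le> p + r \<and> \<xi> t \<le> max (m + e) (q t - r) \<and> min (m - e) (q t + r) \<le> \<xi> t"
    if e: "e > 0" for e
  proof -
    have e4: "e/4 > 0" using e by simp
    obtain b where b: "b < t" "\<And>x. b < x \<Longrightarrow> x < t \<Longrightarrow> \<bar>q x - p\<bar> < e/4"
      using q e4 unfolding tendsto_at_left_real_iff by blast
    obtain c where c: "c < t" "\<And>x. c < x \<Longrightarrow> x < t \<Longrightarrow> \<bar>\<xi> x - m\<bar> < e/4"
      using \<xi> e4 unfolding tendsto_at_left_real_iff by blast
    \<comment> \<open>a time so close to \<open>t\<close> that both left limits are nearly reached from \<open>s\<close> on\<close>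
    define s where "s = (max 0 (max b c) + t) / 2"
    have s: "0 < s" "s < t" "b < s" "c < s" using b c t by (auto simp: s_def)
    have near: "\<bar>q s - p\<bar> < e/4" "\<bar>\<xi> s - m\<bar> < e/4" "\<bar>q s - \<xi> s\<bar> \<le> r"
      using b(2)[of s] c(2)[of s] s t threshold_ruleD(1)[OF rule, of s] by auto
    have "\<xi> t \<le> max (\<xi> s) (max (p + e/4 - r) (q t - r))"
    proof (rule threshold_ruleD(2)[OF rule])
      show "q x - r \<le> max (p + e/4 - r) (q t - r)" if "s < x" "x \<le> t" for x
      proof (cases "x = t")
        case False
        then have "\<bar>q x - p\<bar> < e/4" using b(2)[of x] that s by simp
        then have "q x - r \<le> p + e/4 - r" by linarith
        then show ?thesis by (rule max.coboundedI1)
      qed simp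
    qed (use s t in auto)
    moreover have "min (\<xi> s) (min (p - e/4 + r) (q t + r)) \<le> \<xi> t"
    proof (rule threshold_ruleD(3)[OF rule])
      show "min (p - e/4 + r) (q t + r) \<le> q x + r" if "s < x" "x \<le> t" for x
      proof (cases "x = t")
        case False
        then have "\<bar>q x - p\<bar> < e/4" using b(2)[of x] that s by simp
        then have "p - e/4 + r \<le> q x + r" by linarith
        then show ?thesis by (rule min.coboundedI1)
      qed simp
    qed (use s t in auto)
    moreover have "p - r \<le> m + e" "m - e \<le> p + r" using near by linarith+
    moreover have "\<xi> s \<le> m + e" "m - e \<le> \<xi> s" using near by linarith+
    moreover have "p + e/4 - r \<le> m + e" "m - e \<le> p - e/4 + r" using near by linarith+
    ultimately show ?thesis by (auto simp: le_max_iff_disj min_le_iff_disj)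
  qed
  consider "m < \<xi> t" | "\<xi> t < m" | "m = \<xi> t" by linarith
  then show ?thesis
  proof cases
    case 1
    then have e: "(\<xi> t - m) / 2 > 0" by simp
    have "\<xi> t \<le> m + (\<xi> t - m) / 2 \<or> \<xi> t \<le> q t - r" using pm[OF e] by (simp only: le_max_iff_disj)
    then have "\<xi> t \<le> q t - r" using 1 by (auto simp: field_simps)
    then show ?thesis using 1 \<zeta> by (intro mult_nonneg_nonneg) auto
  next
    case 2
    then have e: "(m - \<xi> t) / 2 > 0" by simp
    have "m - (m - \<xi> t) / 2 \<le> \<xi> t \<or> q t + r \<le> \<xi> t" using pm[OF e] by (simp only: min_le_iff_disj)
    then have "q t + r \<le> \<xi> t" using 2 by (auto simp: field_simps)
    then show ?thesis using 2 \<zeta> by (intro mult_nonpos_nonpos) auto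
  qed simp
qed

text \<open>
  A primitive whose error and whose possible negative increment are both charged to the increment of
  \<open>U\<close>, which makes the notion additive over adjacent intervals.
\<close>

definition KS_piece ::
    "(real \<Rightarrow> real) \<Rightarrow> (real \<Rightarrow> real) \<Rightarrow> real \<Rightarrow> (real \<Rightarrow> real) \<Rightarrow> real \<Rightarrow> real \<Rightarrow> bool" where
  "KS_piece f g \<epsilon> U x y \<longleftrightarrow> (\<exists>F W. KS_primitive f g x y F W \<and>
     W y - W x \<le> \<epsilon> * (U y - U x) \<and> F y - F x \<ge> - \<epsilon> * (U y - U x))"

lemma KS_pieceI:
  "KS_primitive f g x y F W \<Longrightarrow> W y - W x \<le> \<epsilon> * (U y - U x) \<Longrightarrow> - \<epsilon> * (U y - U x) \<le> F y - F x \<Longrightarrow>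
    KS_piece f g \<epsilon> U x y"
  unfolding KS_piece_def by blast

text \<open>
  Both pieces are taken so short that \<open>q\<close> and \<open>f\<close> are within \<open>\<epsilon>\<close> of their one-sided limits. The term \<open>V\<close>
  of \<open>U\<close> pays for the oscillation of \<open>f\<close>, the term \<open>x\<close> for the constant errors at the end points: the
  number of pieces is not under control, but their total length is.
\<close>

lemma threshold_rule_local_pieces:
  assumes f: "f = (\<lambda>x. q x - \<xi> x - z x)" and U: "U = (\<lambda>x. V x + x)"
    and rule: "threshold_rule T r q \<xi>" and q: "q \<in> G_R T"
    and V: "variation_majorant 0 T \<xi> V"
    and z: "regulated_on 0 T z" "\<And>x. 0 \<le> x \<Longrightarrow> x \<le> T \<Longrightarrow> \<bar>z x\<bar> \<le> r" and \<epsilon>: "\<epsilon> > 0"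
  shows "\<And>x. 0 \<le> x \<Longrightarrow> x < T \<Longrightarrow> \<exists>y. x < y \<and> y \<le> T \<and> KS_piece f \<xi> \<epsilon> U x y" (is "PROP ?right")
    and "\<And>x. 0 < x \<Longrightarrow> x \<le> T \<Longrightarrow> \<exists>d<x. 0 \<le> d \<and> (\<forall>y. d < y \<and> y < x \<longrightarrow> KS_piece f \<xi> \<epsilon> U y x)"
      (is "PROP ?left")
proof -
  have \<xi>: "\<xi> \<in> G_R T" by (rule threshold_rule_G_R[OF rule q])
  have z_le: "\<bar>\<zeta>\<bar> \<le> r" if lim: "(z \<longlongrightarrow> \<zeta>) G" and ev: "\<forall>\<^sub>F x in G. 0 \<le> x \<and> x \<le> T" and "G \<noteq> bot" for \<zeta> G
  proof (rule tendsto_upperbound[OF tendsto_rabs[OF lim]])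
    show "\<forall>\<^sub>F x in G. \<bar>z x\<bar> \<le> r" using ev by eventually_elim (simp add: z)
  qed fact
  have V_part: "variation_majorant x y \<xi> V" if "0 \<le> x" "y \<le> T" for x y
    using V that unfolding variation_majorant_def by auto
  have budget: "- \<epsilon> * (U y - U x) \<le> D" if "- \<epsilon> * (V y - V x) \<le> D" "x \<le> y" for x y D
  proof -
    have "0 \<le> \<epsilon> * (y - x)" using \<epsilon> that by simp
    then show ?thesis using that by (simp add: U algebra_simps)
  qed
  show "PROP ?right"
  proof -
    fix x assume x: "0 \<le> x" "x < T"
    have q_lim: "(q \<longlongrightarrow> q x) (at_right x)" and \<xi>_lim: "(\<xi> \<longlongrightarrow> \<xi> x) (at_right x)"
      using G_RD(1)[OF q] G_RD(1)[OF \<xi>] x by auto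
    obtain \<zeta> where z_lim: "(z \<longlongrightarrow> \<zeta>) (at_right x)" using z(1) x unfolding regulated_on_def by force
    define l where "l = q x - \<xi> x - \<zeta>"
    have f_lim: "(f \<longlongrightarrow> l) (at_right x)"
      unfolding f l_def by (intro tendsto_diff q_lim \<xi>_lim z_lim)
    have "\<forall>\<^sub>F y in at_right x. 0 \<le> y \<and> y \<le> T"
      unfolding eventually_at_right_field using x by (intro exI[of _ T]) auto
    then have \<zeta>: "\<bar>\<zeta>\<bar> \<le> r" by (rule z_le[OF z_lim]) simp
    obtain b1 where b1: "b1 > x" "\<And>y. x < y \<Longrightarrow> y < b1 \<Longrightarrow> \<bar>q y - q x\<bar> < \<epsilon>"
      using q_lim \<epsilon> unfolding tendsto_at_right_real_iff by blast
    obtain b2 where b2: "b2 > x" "\<And>y. x < y \<Longrightarrow> y < b2 \<Longrightarrow> \<bar>f y - l\<bar> < \<epsilon>"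
      using f_lim \<epsilon> unfolding tendsto_at_right_real_iff by blast
    define y where "y = (x + min (min b1 b2) T) / 2"
    have y: "x < y" "y \<le> T" "y < b1" "y < b2" using b1 b2 x by (auto simp: y_def)
    define F where "F = (\<lambda>t. l * \<xi> t)"
    define W where "W = (\<lambda>t. \<epsilon> * V t + (if x < t then \<epsilon> * (y - x) else 0))"
    have "KS_primitive f \<xi> x y F W"
      unfolding F_def W_def
    proof (rule KS_primitive_right_piece[OF V_part \<xi>_lim])
      show "\<bar>f t - l\<bar> \<le> \<epsilon>" if "x < t" "t \<le> y" for t using b2(2)[of t] that y by simp
    qed (use x y \<epsilon> in auto)
    moreover have "W y - W x \<le> \<epsilon> * (U y - U x)" using y by (simp add: W_def U algebra_simps)
    moreover have "- \<epsilon> * (U y - U x) \<le> F y - F x"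
    proof (rule budget)
      have "- \<epsilon> * \<bar>\<xi> y - \<xi> x\<bar> \<le> l * (\<xi> y - \<xi> x)"
        unfolding l_def
      proof (rule threshold_rule_dissipation[OF rule])
        show "\<bar>q t - q x\<bar> \<le> \<epsilon>" if "x < t" "t \<le> y" for t using b1(2)[of t] that y by simp
      qed (use x y \<zeta> in auto)
      moreover have "\<epsilon> * \<bar>\<xi> y - \<xi> x\<bar> \<le> \<epsilon> * (V y - V x)"
        using variation_majorantD[OF V, of x y] x y \<epsilon> by (intro mult_left_mono) auto
      ultimately show "- \<epsilon> * (V y - V x) \<le> F y - F x" by (simp add: F_def algebra_simps)
    qed (use y in simp)
    ultimately have "KS_piece f \<xi> \<epsilon> U x y" by (rule KS_pieceI)
    then show "\<exists>y. x < y \<and> y \<le> T \<and> KS_piece f \<xi> \<epsilon> U x y" using y(1,2) by blast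
  qed
  show "PROP ?left"
  proof -
    fix x assume x: "0 < x" "x \<le> T"
    obtain p where q_lim: "(q \<longlongrightarrow> p) (at_left x)" using G_RD(2)[OF q] x by auto
    obtain m where \<xi>_lim: "(\<xi> \<longlongrightarrow> m) (at_left x)" using G_RD(2)[OF \<xi>] x by auto
    obtain \<zeta> where z_lim: "(z \<longlongrightarrow> \<zeta>) (at_left x)" using z(1) x unfolding regulated_on_def by force
    define l where "l = p - m - \<zeta>"
    have f_lim: "(f \<longlongrightarrow> l) (at_left x)"
      unfolding f l_def by (intro tendsto_diff q_lim \<xi>_lim z_lim)
    have "\<forall>\<^sub>F y in at_left x. 0 \<le> y \<and> y \<le> T"
      unfolding eventually_at_left_field using x by (intro exI[of _ 0]) auto
    then have \<zeta>: "\<bar>\<zeta>\<bar> \<le> r" by (rule z_le[OF z_lim]) simp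
    obtain b1 where b1: "b1 < x" "\<And>y. b1 < y \<Longrightarrow> y < x \<Longrightarrow> \<bar>q y - p\<bar> < \<epsilon>"
      using q_lim \<epsilon> unfolding tendsto_at_left_real_iff by blast
    obtain b2 where b2: "b2 < x" "\<And>y. b2 < y \<Longrightarrow> y < x \<Longrightarrow> \<bar>f y - l\<bar> < \<epsilon>"
      using f_lim \<epsilon> unfolding tendsto_at_left_real_iff by blast
    define d where "d = max 0 (max b1 b2)"
    have "KS_piece f \<xi> \<epsilon> U y x" if "d < y \<and> y < x" for y
    proof -
      have y: "0 < y" "y < x" "b1 < y" "b2 < y" using that by (auto simp: d_def)
      define F where "F = (\<lambda>t. if t < x then l * \<xi> t else l * m + f x * (\<xi> x - m))"
      define W where "W = (\<lambda>t. \<epsilon> * V t + (if t < x then 0 else \<epsilon> * (x - y)))"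
      have "KS_primitive f \<xi> y x F W"
        unfolding F_def W_def
      proof (rule KS_primitive_left_piece[OF V_part \<xi>_lim])
        show "\<bar>f t - l\<bar> \<le> \<epsilon>" if "y \<le> t" "t < x" for t using b2(2)[of t] that y by simp
      qed (use x y \<epsilon> in auto)
      moreover have "W x - W y \<le> \<epsilon> * (U x - U y)" using y by (simp add: W_def U algebra_simps)
      moreover have "- \<epsilon> * (U x - U y) \<le> F x - F y"
      proof (rule budget)
        have ev: "\<forall>\<^sub>F t in at_left x. y < t \<and> t < x"
          unfolding eventually_at_left_field using y by blast
        have part: "- \<epsilon> * (V x - V y) \<le> (p - \<xi> t - \<zeta>) * (\<xi> t - \<xi> y)" if t: "y < t \<and> t < x" for t
        proof -
          have "- \<epsilon> * \<bar>\<xi> t - \<xi> y\<bar> \<le> (p - \<xi> t - \<zeta>) * (\<xi> t - \<xi> y)"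
          proof (rule threshold_rule_dissipation[OF rule])
            show "\<bar>q u - p\<bar> \<le> \<epsilon>" if "y < u" "u \<le> t" for u using b1(2)[of u] that y t by simp
          qed (use x y t \<zeta> in auto)
          moreover have "\<bar>\<xi> t - \<xi> y\<bar> \<le> V t - V y" "\<bar>\<xi> x - \<xi> t\<bar> \<le> V x - V t"
            by (rule variation_majorantD[OF V]; use x y t in simp)+
          then have "\<epsilon> * \<bar>\<xi> t - \<xi> y\<bar> \<le> \<epsilon> * (V x - V y)" using \<epsilon> by (intro mult_left_mono) auto
          ultimately show ?thesis by simp
        qed
        have "- \<epsilon> * (V x - V y) \<le> l * (m - \<xi> y)"
        proof (rule tendsto_lowerbound)
          show "((\<lambda>t. (p - \<xi> t - \<zeta>) * (\<xi> t - \<xi> y)) \<longlongrightarrow> l * (m - \<xi> y)) (at_left x)"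
            unfolding l_def by (intro tendsto_intros \<xi>_lim)
          show "\<forall>\<^sub>F t in at_left x. - \<epsilon> * (V x - V y) \<le> (p - \<xi> t - \<zeta>) * (\<xi> t - \<xi> y)"
            using ev by eventually_elim (rule part)
        qed simp
        moreover have "0 \<le> f x * (\<xi> x - m)"
          unfolding f by (rule threshold_rule_jump[OF rule x q_lim \<xi>_lim]) (use z(2) x in auto)
        ultimately show "- \<epsilon> * (V x - V y) \<le> F x - F y" using y by (simp add: F_def algebra_simps)
      qed (use y in simp)
      ultimately show ?thesis by (rule KS_pieceI)
    qed
    moreover have "d < x" "0 \<le> d" using b1 b2 x by (auto simp: d_def)
    ultimately show "\<exists>d<x. 0 \<le> d \<and> (\<forall>y. d < y \<and> y < x \<longrightarrow> KS_piece f \<xi> \<epsilon> U y x)"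
      by blast
  qed
qed

lemma threshold_rule_variational_inequality:
  assumes rule: "threshold_rule T r q \<xi>" and q: "q \<in> G_R T" and T: "0 \<le> T"
    and V: "variation_majorant 0 T \<xi> V"
    and z: "regulated_on 0 T z" "\<And>x. 0 \<le> x \<Longrightarrow> x \<le> T \<Longrightarrow> \<bar>z x\<bar> \<le> r"
  shows "\<exists>I\<ge>0. has_KS_integral (\<lambda>t. q t - \<xi> t - z t) \<xi> 0 T I"
proof (rule has_KS_integral_exists[OF T])
  fix e :: real assume e: "e > 0"
  define U where "U = (\<lambda>x. V x + x)"
  \<comment> \<open>chosen so that the whole budget \<open>\<epsilon> (U T - U 0)\<close> is at most \<open>e\<close>\<close>
  define \<epsilon> where "\<epsilon> = e / (U T - U 0 + 1)"
  have "0 \<le> U T - U 0" using variation_majorantD[OF V, of 0 T] T by (auto simp: U_def)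
  then have \<epsilon>: "\<epsilon> > 0" "\<epsilon> * (U T - U 0) \<le> e" using e by (auto simp: \<epsilon>_def field_simps)
  define f where "f = (\<lambda>t. q t - \<xi> t - z t)"
  note local = threshold_rule_local_pieces[OF f_def U_def rule q V z \<epsilon>(1)]
  have "KS_piece f \<xi> \<epsilon> U 0 T"
    using T
  proof (rule interval_concat_induct)
    have "KS_primitive f \<xi> x x (\<lambda>_. 0) (\<lambda>_. 0)" for x
      by (rule KS_primitiveI) (auto intro: exI[of _ 1])
    then show "KS_piece f \<xi> \<epsilon> U x x" for x
      by (rule KS_pieceI) simp_all
    show "KS_piece f \<xi> \<epsilon> U x y'" if xyz: "x < y" "y < y'" and Q: "KS_piece f \<xi> \<epsilon> U x y" "KS_piece f \<xi> \<epsilon> U y y'"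
      for x y y'
    proof -
      from Q obtain F W F' W' where 1: "KS_primitive f \<xi> x y F W"
          "W y - W x \<le> \<epsilon> * (U y - U x)" "F y - F x \<ge> - \<epsilon> * (U y - U x)"
        and 2: "KS_primitive f \<xi> y y' F' W'"
          "W' y' - W' y \<le> \<epsilon> * (U y' - U y)" "F' y' - F' y \<ge> - \<epsilon> * (U y' - U y)"
        unfolding KS_piece_def by blast
      have "KS_primitive f \<xi> x y' (glue y F F') (glue y W W')"
        by (rule KS_primitive_glue[OF xyz 1(1) 2(1)])
      then show ?thesis
        by (rule KS_pieceI) (use xyz 1(2,3) 2(2,3) in \<open>auto simp: glue_def algebra_simps\<close>)
    qed
  qed (use local in auto)
  then obtain F W where "KS_primitive f \<xi> 0 T F W"
    "W T - W 0 \<le> \<epsilon> * (U T - U 0)" "- \<epsilon> * (U T - U 0) \<le> F T - F 0" unfolding KS_piece_def by blast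
  then show "\<exists>F W. KS_primitive (\<lambda>t. q t - \<xi> t - z t) \<xi> 0 T F W \<and> W T - W 0 \<le> e \<and> F T - F 0 \<ge> - e"
    using \<epsilon>(2) by (intro exI[of _ F] exI[of _ W]) (auto simp: f_def)
qed

theorem is_play_exists:
  assumes T: "0 \<le> T" and q: "q \<in> G_R T" and r: "r > 0"
  shows "\<exists>\<xi>. is_play T r q \<xi>"
proof -
  obtain \<xi> where rule: "threshold_rule T r q \<xi>" and init: "\<xi> 0 = max (q 0 - r) (min 0 (q 0 + r))"
    using threshold_rule_solution[OF r] by blast
  obtain V where V: "variation_majorant 0 T \<xi> V" using threshold_rule_variation[OF rule q r T] ..
  have "\<xi> \<in> BV_R T"
    using threshold_rule_G_R[OF rule q] variation_majorant_bounded[OF T V] by (simp add: BV_R_def)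
  moreover have "\<exists>I\<ge>0. has_KS_integral (\<lambda>t. q t - \<xi> t - z t) \<xi> 0 T I"
    if "regulated_on 0 T z \<and> (\<forall>t\<in>{0..T}. \<bar>z t\<bar> \<le> r)" for z
    by (rule threshold_rule_variational_inequality[OF rule q T V]) (use that in auto)
  ultimately have "is_play T r q \<xi>"
    using init threshold_ruleD(1)[OF rule] by (simp add: is_play_def)
  then show ?thesis by blast
qed

lemma play_is_play:
  assumes "0 \<le> T" "q \<in> G_R T" "r > 0"
  shows "is_play T r q (play T r q)"
  unfolding play_def by (rule someI_ex[OF is_play_exists[OF assms]])

section \<open>Lebesgue null sets and Borel versions\<close>

lemma AE_lborel_prod_slice:
  fixes P :: "'a::euclidean_space \<times> 'b::euclidean_space \<Rightarrow> bool"
  assumes "AE p in lborel. P p"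
  shows "AE x in lborel. AE y in lborel. P (x, y)"
  using assms by (intro lborel_pair.AE_pair) (simp only: lborel_prod)

lemma AE_lborel_fstI:
  fixes P :: "'a::euclidean_space \<Rightarrow> bool"
  assumes "AE x in lborel. P x"
  shows "AE p in (lborel :: ('a \<times> 'b::euclidean_space) measure). P (fst p)"
proof -
  obtain N where N: "{x \<in> space lborel. \<not> P x} \<subseteq> N" "emeasure lborel N = 0" "N \<in> sets lborel"
    using AE_E[OF assms] by blast
  have "AE p in (lborel \<Otimes>\<^sub>M lborel :: ('a \<times> 'b) measure). fst p \<notin> N"
  proof (rule lborel_pair.AE_pair_measure)
    have [measurable]: "N \<in> sets borel" using N(3) by simp
    show "{p \<in> space (lborel \<Otimes>\<^sub>M lborel :: ('a \<times> 'b) measure). fst p \<notin> N} \<in> sets (lborel \<Otimes>\<^sub>M lborel)"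
      by measurable
    have "AE x in lborel. x \<notin> N" using N by (intro AE_not_in) auto
    then show "AE x in lborel. AE y in (lborel :: 'b measure). fst (x, y) \<notin> N"
      by eventually_elim simp
  qed
  then have "AE p in (lborel :: ('a \<times> 'b) measure). fst p \<notin> N" by (simp only: lborel_prod)
  then show ?thesis by eventually_elim (use N(1) in auto)
qed

text \<open>
  Completeness of Lebesgue measure makes \<open>f\<close> measurable.
\<close>

lemma integral_lebesgue_AE_borel:
  fixes f g :: "'a::euclidean_space \<Rightarrow> real"
  assumes g: "g \<in> borel_measurable borel" and eq: "AE x in lborel. f x = g x"
  shows "integral\<^sup>L lebesgue f = integral\<^sup>L lborel g"
proof -
  have g': "g \<in> borel_measurable lebesgue" using g by (simp add: measurable_completion)
  have eq': "AE x in lebesgue. f x = g x" using eq by (simp add: AE_completion_iff)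
  have "f \<in> borel_measurable lebesgue"
  proof (rule measurableI)
    fix A :: "real set" assume A: "A \<in> sets borel"
    show "f -` A \<inter> space lebesgue \<in> sets lebesgue"
    proof (rule completion.in_sets_AE)
      show "g -` A \<inter> space lebesgue \<in> sets lebesgue" by (rule measurable_sets[OF g' A])
      show "AE x in lebesgue. (x \<in> g -` A \<inter> space lebesgue) = (x \<in> f -` A \<inter> space lebesgue)"
        using eq' by eventually_elim auto
    qed simp
  qed simp
  then have "integral\<^sup>L lebesgue f = integral\<^sup>L lebesgue g" using g' eq' by (rule integral_cong_AE)
  also have "\<dots> = integral\<^sup>L lborel g" by (rule integral_completion) (use g in simp)
  finally show ?thesis .
qed

lemma integrable_lebesgue_on_borel_version:
  fixes f :: "'a::euclidean_space \<Rightarrow> real"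
  assumes f: "integrable (lebesgue_on S) f" and S: "S \<in> sets lebesgue"
  obtains g where "integrable lborel g" "AE x in lborel. g x = (if x \<in> S then f x else 0)"
proof -
  let ?F = "\<lambda>x. indicator S x *\<^sub>R f x"
  have F: "integrable lebesgue ?F" using f S by (subst (asm) integrable_restrict_space) auto
  then obtain g where g: "g \<in> borel_measurable lborel" "AE x in lborel. ?F x = g x"
    using completion_ex_borel_measurable_real[of ?F lborel] by auto
  have "g \<in> borel_measurable lebesgue" using g(1) by (rule measurable_completion)
  moreover have "AE x in lebesgue. ?F x = g x" using g(2) by (rule AE_completion)
  ultimately have "integrable lebesgue g" using F integrable_cong_AE[of ?F lebesgue g] by auto
  then have "integrable lborel g" using integrable_completion[OF g(1)] by simp
  moreover have "AE x in lborel. g x = (if x \<in> S then f x else 0)"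
    using g(2) by eventually_elim (auto simp: indicator_def)
  ultimately show thesis by (rule that)
qed

lemma AE_lborel_dense:
  fixes P :: "'a::euclidean_space \<Rightarrow> bool"
  assumes "AE x in lborel. P x"
  obtains s where "\<And>n. P (s n)" "s \<longlonglongrightarrow> u"
proof -
  have "AE x in lebesgue. x \<in> closure {x. P x}"
    using AE_completion[OF assms] by eventually_elim (rule subsetD[OF closure_subset], simp)
  then have "u \<in> closure {x. P x}" using mem_closed_if_AE_lebesgue[OF closed_closure] by blast
  then show thesis using that unfolding closure_sequential by auto
qed

text \<open>
  Joint Lebesgue measurability only makes almost every slice \<open>F u\<close> measurable. Full-measure sets are
  dense, so every \<open>u\<close> is a limit of parameters with measurable slices, and continuity in the parameter
  identifies \<open>F u\<close> as an almost everywhere limit of these slices.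
\<close>

lemma borel_slices_of_continuous:
  fixes F :: "'a::euclidean_space \<Rightarrow> 'b::euclidean_space \<Rightarrow> real"
  assumes F: "(\<lambda>(u, p). F u p) \<in> borel_measurable lebesgue"
    and cont: "AE p in lborel. \<forall>u. isCont (\<lambda>u. F u p) u"
  shows "\<exists>f \<in> borel_measurable borel. AE p in lborel. f p = F u p"
proof -
  obtain g where g: "g \<in> borel_measurable (lborel :: ('a \<times> 'b) measure)"
      "AE x in lborel. (case x of (u, p) \<Rightarrow> F u p) = g x"
    using completion_ex_borel_measurable_real[OF F] by blast
  have [measurable]: "g \<in> borel_measurable (borel \<Otimes>\<^sub>M borel)" using g(1) by (simp add: borel_prod)
  have "AE u in lborel. AE p in lborel. F u p = g (u, p)"
    using AE_lborel_prod_slice[OF g(2)] by simp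
  then obtain s where s: "\<And>n. AE p in lborel. F (s n) p = g (s n, p)" "s \<longlonglongrightarrow> u"
    using AE_lborel_dense[of "\<lambda>u. AE p in lborel. F u p = g (u, p)" u] by blast
  define f where "f = (\<lambda>p. lim (\<lambda>n. g (s n, p)))"
  have "f \<in> borel_measurable borel" unfolding f_def by measurable
  moreover have "AE p in lborel. \<forall>n. F (s n) p = g (s n, p)" using s(1) by (simp add: AE_all_countable)
  with cont have "AE p in lborel. f p = F u p"
  proof eventually_elim
    case (elim p)
    have "(\<lambda>n. F (s n) p) \<longlonglongrightarrow> F u p" by (rule isCont_tendsto_compose[OF _ s(2)]) (use elim in blast)
    then show ?case using elim by (auto simp: f_def intro: limI)
  qed
  ultimately show ?thesis by blast
qed

lemma abs_diff_le_gradient_bound: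
  fixes f :: "'a::real_inner \<Rightarrow> real"
  assumes "\<And>u. \<exists>D. GDERIV f u :> D \<and> norm D \<le> K"
  shows "\<bar>f u - f v\<bar> \<le> K * norm (u - v)"
proof -
  obtain D where D: "\<And>u. GDERIV f u :> D u" "\<And>u. norm (D u) \<le> K" using assms by metis
  have "norm (f u - f v) \<le> K * norm (u - v)"
  proof (rule differentiable_bound[of UNIV f "\<lambda>u h. inner h (D u)"])
    show "(f has_derivative (\<lambda>h. inner h (D x))) (at x within UNIV)" for x
      using D(1)[of x] by (simp add: gderiv_def)
    show "onorm (\<lambda>h. inner h (D x)) \<le> K" for x
    proof (rule onorm_bound)
      show "0 \<le> K" using D(2) norm_ge_zero by (rule order_trans[rotated])
      fix h
      have "norm (inner h (D x)) \<le> norm h * norm (D x)" by (simp add: Cauchy_Schwarz_ineq2)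
      also have "\<dots> \<le> norm h * K" by (intro mult_left_mono D(2)) simp
      finally show "norm (inner h (D x)) \<le> K * norm h" by (simp add: mult.commute)
    qed
  qed auto
  then show ?thesis by simp
qed

section \<open>The Preisach integral over the half-plane\<close>

text \<open>
  The data of the Preisach operator after passing to Borel versions, with pairs \<open>p = (r, v)\<close>. The
  exceptional null sets may depend on \<open>u\<close>, because each slice is modified separately.
\<close>

definition borel_density ::
    "('a::real_normed_vector \<Rightarrow> real \<times> real \<Rightarrow> real) \<Rightarrow> (real \<Rightarrow> real) \<Rightarrow> (real \<times> real \<Rightarrow> real) \<Rightarrow> bool" where
  "borel_density \<phi> m k \<longleftrightarrow> integrable lborel m \<and> integrable lborel k \<and>
     (\<forall>u. \<phi> u \<in> borel_measurable borel) \<and>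
     (\<forall>u. AE p in lborel. 0 \<le> \<phi> u p \<and> \<phi> u p \<le> m (fst p)) \<and>
     (\<forall>u v. AE p in lborel. \<bar>\<phi> u p - \<phi> v p\<bar> \<le> k p * norm (u - v))"

text \<open>
  The density is extended by \<open>0\<close> to \<open>r \<le> 0\<close>, where all bounds hold trivially, so that Lebesgue measure
  on the whole plane can be used.
\<close>

lemma preisach_density_borel:
  fixes \<psi> :: "real ^ 'l::finite \<Rightarrow> real \<Rightarrow> real \<Rightarrow> real"
  assumes "preisach_density \<psi>"
  obtains \<phi> m k where "borel_density \<phi> m k"
    "\<And>u. AE p in lborel. \<phi> u p = (if 0 < fst p then \<psi> u (fst p) (snd p) else 0)"
proof -
  define F where "F u p = (if 0 < fst p then \<psi> u (fst p) (snd p) else 0)" for u p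
  have halves: "{0<..} \<times> UNIV \<in> sets (lebesgue :: (real \<times> real) measure)"
    "UNIV \<times> {0<..} \<times> UNIV \<in> sets (lebesgue :: ((real ^ 'l) \<times> real \<times> real) measure)"
    by (rule borel_open[THEN sets_completionI_sets[OF _, of _ lborel, simplified]]; intro open_Times open_UNIV open_greaterThan)+
  obtain \<mu> K where meas: "(\<lambda>(u, r, v). \<psi> u r v) \<in> borel_measurable (lebesgue_on (UNIV \<times> {0<..} \<times> UNIV))"
    and \<mu>: "integrable (lebesgue_on {0<..}) \<mu>"
    and K: "integrable (lebesgue_on ({0<..} \<times> UNIV)) (\<lambda>(r, v). K r v)"
    and bounds: "AE (r, v) in lebesgue_on ({0<..} \<times> UNIV). \<forall>u. 0 \<le> \<psi> u r v \<and> \<psi> u r v \<le> \<mu> r \<and>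
        (\<exists>D. GDERIV (\<lambda>u. \<psi> u r v) u :> D \<and> norm D \<le> K r v)"
    using assms unfolding preisach_density_def by blast
  obtain m where m: "integrable lborel m" "AE r in lborel. m r = (if r \<in> {0<..} then \<mu> r else 0)"
    using integrable_lebesgue_on_borel_version[OF \<mu>] by auto
  obtain k where k: "integrable lborel k"
      "AE p in lborel. k p = (if p \<in> {0<..} \<times> UNIV then (case p of (r, v) \<Rightarrow> K r v) else 0)"
    using integrable_lebesgue_on_borel_version[OF K halves(1)] by auto
  have "AE p in lebesgue. p \<in> {0<..} \<times> UNIV \<longrightarrow> (case p of (r, v) \<Rightarrow> \<forall>u. 0 \<le> \<psi> u r v \<and> \<psi> u r v \<le> \<mu> r \<and>
        (\<exists>D. GDERIV (\<lambda>u. \<psi> u r v) u :> D \<and> norm D \<le> K r v))"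
    using bounds by (subst (asm) AE_restrict_space_iff) (use halves in auto)
  then have bounds': "AE p in lborel. p \<in> {0<..} \<times> UNIV \<longrightarrow> (case p of (r, v) \<Rightarrow> \<forall>u. 0 \<le> \<psi> u r v \<and> \<psi> u r v \<le> \<mu> r \<and>
        (\<exists>D. GDERIV (\<lambda>u. \<psi> u r v) u :> D \<and> norm D \<le> K r v))"
    by (simp add: AE_completion_iff)
  have F_bounds: "AE p in lborel. \<forall>u. 0 \<le> F u p \<and> F u p \<le> m (fst p) \<and>
      (\<exists>D. GDERIV (\<lambda>u. F u p) u :> D \<and> norm D \<le> k p)"
    using bounds' AE_lborel_fstI[OF m(2), where 'b=real] k(2)
  proof eventually_elim
    case (elim p)
    obtain r v where p: "p = (r, v)" by force
    show ?case
    proof (cases "0 < r")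
      case True
      then show ?thesis using elim by (simp add: p F_def)
    next
      case False
      have "GDERIV (\<lambda>u. 0) u :> 0" for u :: "real ^ 'l" by (simp add: gderiv_def)
      then show ?thesis using elim False by (auto simp: p F_def intro!: exI[of _ 0])
    qed
  qed
  have "\<exists>\<phi> \<in> borel_measurable borel. AE p in lborel. \<phi> p = F u p" for u
  proof (rule borel_slices_of_continuous)
    have "(\<lambda>x. if x \<in> UNIV \<times> {0<..} \<times> UNIV then (case x of (u, r, v) \<Rightarrow> \<psi> u r v) else 0) \<in> borel_measurable lebesgue"
      by (rule borel_measurable_if_I[OF meas halves(2)])
    moreover have "(\<lambda>x. if x \<in> UNIV \<times> {0<..} \<times> UNIV then (case x of (u, r, v) \<Rightarrow> \<psi> u r v) else 0) =
        (\<lambda>(u, p). F u p)" by (auto simp: F_def fun_eq_iff)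
    ultimately show "(\<lambda>(u, p). F u p) \<in> borel_measurable lebesgue" by simp
    show "AE p in lborel. \<forall>u. isCont (\<lambda>u. F u p) u"
      using F_bounds by eventually_elim (auto simp: gderiv_def intro: has_derivative_continuous)
  qed
  then obtain \<phi> where \<phi>: "\<And>u. \<phi> u \<in> borel_measurable borel" "\<And>u. AE p in lborel. \<phi> u p = F u p"
    by metis
  have "AE p in lborel. 0 \<le> \<phi> u p \<and> \<phi> u p \<le> m (fst p)" for u
    using F_bounds \<phi>(2)[of u] by eventually_elim auto
  moreover have "AE p in lborel. \<bar>\<phi> u p - \<phi> v p\<bar> \<le> k p * norm (u - v)" for u v
    using F_bounds \<phi>(2)[of u] \<phi>(2)[of v]
  proof eventually_elim
    case (elim p)
    then show ?case using abs_diff_le_gradient_bound[of "\<lambda>u. F u p" "k p" u v] by simp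
  qed
  ultimately have "borel_density \<phi> m k" using m(1) k(1) \<phi>(1) by (simp add: borel_density_def)
  then show thesis using that \<phi>(2) by (simp add: F_def)
qed

text \<open>
  Integration against this function of \<open>v\<close> is the oriented integral from \<open>0\<close> to \<open>x\<close>.
\<close>

definition oriented_indicator :: "real \<Rightarrow> real \<Rightarrow> real" where
  "oriented_indicator x v = (if 0 < v \<and> v < x then 1 else if x < v \<and> v < 0 then -1 else 0)"

lemma interval_integral_oriented:
  "(LINT v=0..ereal x|lebesgue. f v) = integral\<^sup>L lebesgue (\<lambda>v. f v * oriented_indicator x v)"
proof (cases "0 \<le> x")
  case True
  then have "(LINT v=0..ereal x|lebesgue. f v) = (LINT v:{0<..<x}|lebesgue. f v)"
    by (simp add: interval_lebesgue_integral_def zero_ereal_def)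
  also have "\<dots> = integral\<^sup>L lebesgue (\<lambda>v. f v * oriented_indicator x v)"
    unfolding set_lebesgue_integral_def using True
    by (intro Bochner_Integration.integral_cong) (auto simp: oriented_indicator_def indicator_def)
  finally show ?thesis .
next
  case False
  then have "(LINT v=0..ereal x|lebesgue. f v) = - (LINT v:{x<..<0}|lebesgue. f v)"
    by (simp add: interval_lebesgue_integral_def zero_ereal_def)
  also have "\<dots> = integral\<^sup>L lebesgue (\<lambda>v. - (indicator {x<..<0} v *\<^sub>R f v))"
    unfolding set_lebesgue_integral_def by simp
  also have "\<dots> = integral\<^sup>L lebesgue (\<lambda>v. f v * oriented_indicator x v)"
    using False by (intro Bochner_Integration.integral_cong) (auto simp: oriented_indicator_def indicator_def)
  finally show ?thesis .
qed

lemma oriented_indicator_measurable [measurable]: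
  assumes [measurable]: "\<rho> \<in> borel_measurable borel"
  shows "(\<lambda>p::real \<times> real. oriented_indicator (\<rho> (fst p)) (snd p)) \<in> borel_measurable borel"
proof -
  have "(\<lambda>p::real \<times> real. oriented_indicator (\<rho> (fst p)) (snd p)) \<in> borel_measurable (borel \<Otimes>\<^sub>M borel)"
    unfolding oriented_indicator_def by measurable
  then show ?thesis by (simp add: borel_prod)
qed

lemma integrable_lborel_times:
  fixes f g :: "real \<Rightarrow> real"
  assumes f: "integrable lborel f" and g: "integrable lborel g"
  shows "integrable lborel (\<lambda>p. f (fst p) * g (snd p))"
proof -
  have [measurable]: "f \<in> borel_measurable borel" "g \<in> borel_measurable borel" using f g by auto
  have "integrable (lborel \<Otimes>\<^sub>M lborel) (\<lambda>p. f (fst p) * g (snd p))"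
  proof (rule lborel_pair.Fubini_integrable)
    have "integrable lborel (\<lambda>x. \<bar>f x\<bar> * (\<integral>y. \<bar>g y\<bar> \<partial>lborel))"
      using f by (intro integrable_mult_left integrable_abs)
    then show "integrable lborel (\<lambda>x. \<integral>y. norm (f (fst (x, y)) * g (snd (x, y))) \<partial>lborel)"
      by (simp add: abs_mult)
    show "AE x in lborel. integrable lborel (\<lambda>y. f (fst (x, y)) * g (snd (x, y)))" using g by simp
  qed measurable
  then show ?thesis by (simp add: lborel_prod)
qed

lemma integrable_lborel_Icc: "integrable lborel (indicator {a..b} :: real \<Rightarrow> real)"
  by (rule integrable_real_indicator) (auto simp: emeasure_lborel_Icc_eq)

lemma integrable_density_oriented:
  assumes dens: "borel_density \<phi> m k" and \<rho>: "\<rho> \<in> borel_measurable borel" "\<And>r. \<bar>\<rho> r\<bar> \<le> B"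
  shows "integrable lborel (\<lambda>p. \<phi> u p * oriented_indicator (\<rho> (fst p)) (snd p))"
proof (rule Bochner_Integration.integrable_bound)
  show "integrable lborel (\<lambda>p. m (fst p) * indicator {-B..B} (snd p))"
    by (rule integrable_lborel_times) (use dens integrable_lborel_Icc in \<open>auto simp: borel_density_def\<close>)
  have [measurable]: "\<phi> u \<in> borel_measurable borel" using dens by (simp add: borel_density_def)
  note oriented_indicator_measurable[OF \<rho>(1), measurable]
  show "(\<lambda>p. \<phi> u p * oriented_indicator (\<rho> (fst p)) (snd p)) \<in> borel_measurable lborel"
    by (simp, measurable)
  have "AE p in lborel. 0 \<le> \<phi> u p \<and> \<phi> u p \<le> m (fst p)" using dens by (simp add: borel_density_def)
  then show "AE p in lborel. norm (\<phi> u p * oriented_indicator (\<rho> (fst p)) (snd p)) \<le>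
      norm (m (fst p) * indicator {-B..B} (snd p))"
  proof eventually_elim
    case (elim p)
    have "\<bar>oriented_indicator (\<rho> (fst p)) (snd p)\<bar> \<le> indicator {-B..B} (snd p)"
      using \<rho>(2)[of "fst p"] by (auto simp: oriented_indicator_def indicator_def)
    then show ?case using elim unfolding norm_mult by (intro mult_mono) auto
  qed
qed

text \<open>
  Fubini's theorem for the Borel version. For almost every \<open>r\<close> the inner integral does not notice the
  modification of \<open>\<psi>\<close>, and the outer one ignores the remaining \<open>r\<close>.
\<close>

lemma preisach_integral_eq:
  assumes dens: "borel_density \<phi> m k"
    and \<phi>: "AE p in lborel. \<phi> u p = (if 0 < fst p then \<psi> u (fst p) (snd p) else 0)"
    and \<rho>: "\<rho> \<in> borel_measurable borel" "\<And>r. \<bar>\<rho> r\<bar> \<le> B"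
  shows "(LINT r:{0<..}|lebesgue. LINT v=0..ereal (\<rho> r)|lebesgue. \<psi> u r v) =
    integral\<^sup>L lborel (\<lambda>p. \<phi> u p * oriented_indicator (\<rho> (fst p)) (snd p))"
proof -
  let ?h = "\<lambda>p. \<phi> u p * oriented_indicator (\<rho> (fst p)) (snd p)"
  have h: "integrable (lborel \<Otimes>\<^sub>M lborel) ?h"
    using integrable_density_oriented[OF dens \<rho>] by (simp add: lborel_prod)
  have [measurable]: "?h \<in> borel_measurable (borel \<Otimes>\<^sub>M borel)"
    using borel_measurable_integrable[OF h] by (simp add: lborel_prod borel_prod)
  have "AE r in lborel. indicator {0<..} r *\<^sub>R (LINT v=0..ereal (\<rho> r)|lebesgue. \<psi> u r v) =
      (\<integral>v. ?h (r, v) \<partial>lborel)"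
    using AE_lborel_prod_slice[OF \<phi>]
  proof eventually_elim
    case (elim r)
    show ?case
    proof (cases "0 < r")
      case True
      have "integral\<^sup>L lebesgue (\<lambda>v. \<psi> u r v * oriented_indicator (\<rho> r) v) = (\<integral>v. ?h (r, v) \<partial>lborel)"
      proof (rule integral_lebesgue_AE_borel)
        show "(\<lambda>v. ?h (r, v)) \<in> borel_measurable borel" by measurable
        show "AE v in lborel. \<psi> u r v * oriented_indicator (\<rho> r) v = ?h (r, v)"
          using elim by eventually_elim (simp add: True)
      qed
      then show ?thesis using True by (simp add: interval_integral_oriented)
    next
      case False
      have "AE v in lborel. ?h (r, v) = 0" using elim by eventually_elim (simp add: False)
      then have "(\<integral>v. ?h (r, v) \<partial>lborel) = 0" by (rule integral_eq_zero_AE)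
      then show ?thesis using False by simp
    qed
  qed
  then have "(LINT r:{0<..}|lebesgue. LINT v=0..ereal (\<rho> r)|lebesgue. \<psi> u r v) =
      (\<integral>r. (\<integral>v. ?h (r, v) \<partial>lborel) \<partial>lborel)"
    unfolding set_lebesgue_integral_def by (intro integral_lebesgue_AE_borel) measurable
  also have "\<dots> = integral\<^sup>L (lborel \<Otimes>\<^sub>M lborel) ?h" by (rule lborel_pair.integral_fst'[OF h])
  finally show ?thesis by (simp add: lborel_prod)
qed

lemma oriented_indicator_drop_le:
  assumes "x' - \<delta> \<le> x" "\<delta> \<ge> 0"
  shows "oriented_indicator x' v - oriented_indicator x v \<le> indicator {x' - \<delta>..x'} v"
  using assms by (auto simp: oriented_indicator_def indicator_def)

text \<open>
  The two effects are separated by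
  \<open>\<phi>' o\<^sub>1 - \<phi> o\<^sub>2 = \<phi> (o\<^sub>1 - o\<^sub>2) + (\<phi>' - \<phi>) o\<^sub>1\<close>. Since \<open>\<phi> \<ge> 0\<close>, only the part of the first term on which
  \<open>o\<^sub>1 > o\<^sub>2\<close> counts; it lies in a strip of height \<open>\<delta>\<close>. In the second term \<open>\<bar>o\<^sub>1\<bar> \<le> 1\<close>, and the Lipschitz
  bound applies.
\<close>

lemma density_integral_drop_le:
  fixes \<rho> \<rho>' :: "real \<Rightarrow> real"
  assumes dens: "borel_density \<phi> m k" and \<delta>: "\<delta> \<ge> 0"
    and \<rho>: "\<rho> \<in> borel_measurable borel" "\<And>r. \<bar>\<rho> r\<bar> \<le> B"
    and \<rho>': "\<rho>' \<in> borel_measurable borel" "\<And>r. \<bar>\<rho>' r\<bar> \<le> B"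
    and drop: "\<And>r. \<rho>' r - \<delta> \<le> \<rho> r"
  shows "(\<integral>p. \<phi> u' p * oriented_indicator (\<rho>' (fst p)) (snd p) \<partial>lborel) -
      (\<integral>p. \<phi> u p * oriented_indicator (\<rho> (fst p)) (snd p) \<partial>lborel) \<le>
      \<delta> * (\<integral>r. m r \<partial>lborel) + norm (u' - u) * (\<integral>p. k p \<partial>lborel)"
proof -
  have m: "integrable lborel m" and k: "integrable lborel k" using dens by (auto simp: borel_density_def)
  have [measurable]: "m \<in> borel_measurable borel" "\<rho>' \<in> borel_measurable borel" using m \<rho>' by auto
  \<comment> \<open>\<open>m\<close> on the strip of height \<open>\<delta>\<close> below the graph of \<open>\<rho>'\<close>\<close>
  let ?h = "\<lambda>p. m (fst p) * indicator {\<rho>' (fst p) - \<delta>..\<rho>' (fst p)} (snd p)"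
  have h: "integrable (lborel \<Otimes>\<^sub>M lborel) ?h"
  proof (rule Bochner_Integration.integrable_bound)
    show "integrable (lborel \<Otimes>\<^sub>M lborel) (\<lambda>p. m (fst p) * indicator {- (B + \<delta>)..B + \<delta>} (snd p))"
      unfolding lborel_prod by (rule integrable_lborel_times[OF m integrable_lborel_Icc])
    show "?h \<in> borel_measurable (lborel \<Otimes>\<^sub>M lborel)"
      unfolding indicator_def atLeastAtMost_iff by measurable
    have "\<bar>indicator {\<rho>' r - \<delta>..\<rho>' r} v\<bar> \<le> \<bar>indicator {- (B + \<delta>)..B + \<delta>} v :: real\<bar>" for r v
      using \<rho>'(2)[of r] \<delta> by (auto simp: indicator_def abs_le_iff)
    then show "AE p in lborel \<Otimes>\<^sub>M lborel. norm (?h p) \<le> norm (m (fst p) * indicator {- (B + \<delta>)..B + \<delta>} (snd p))"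
      unfolding real_norm_def abs_mult by (intro AE_I2 mult_left_mono) auto
  qed
  have "integral\<^sup>L lborel ?h = (\<integral>r. (\<integral>v. ?h (r, v) \<partial>lborel) \<partial>lborel)"
    using lborel_pair.integral_fst'[OF h] by (simp add: lborel_prod)
  also have "\<dots> = (\<integral>r. m r * \<delta> \<partial>lborel)" using \<delta> by simp
  finally have h_eq: "integral\<^sup>L lborel ?h = \<delta> * (\<integral>r. m r \<partial>lborel)" by simp
  have bounds: "AE p in lborel. 0 \<le> \<phi> u p \<and> \<phi> u p \<le> m (fst p)"
    and lip: "AE p in lborel. \<bar>\<phi> u' p - \<phi> u p\<bar> \<le> k p * norm (u' - u)"
    using dens by (auto simp: borel_density_def)
  note int = integrable_density_oriented[OF dens \<rho>, of u] integrable_density_oriented[OF dens \<rho>', of u']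
  have "(\<integral>p. \<phi> u' p * oriented_indicator (\<rho>' (fst p)) (snd p) \<partial>lborel) -
      (\<integral>p. \<phi> u p * oriented_indicator (\<rho> (fst p)) (snd p) \<partial>lborel) =
      (\<integral>p. \<phi> u' p * oriented_indicator (\<rho>' (fst p)) (snd p) -
         \<phi> u p * oriented_indicator (\<rho> (fst p)) (snd p) \<partial>lborel)"
    using int by simp
  also have "\<dots> \<le> (\<integral>p. ?h p + norm (u' - u) * k p \<partial>lborel)"
  proof (rule integral_mono_AE)
    show "AE p in lborel. \<phi> u' p * oriented_indicator (\<rho>' (fst p)) (snd p) -
         \<phi> u p * oriented_indicator (\<rho> (fst p)) (snd p) \<le> ?h p + norm (u' - u) * k p"
      using bounds lip
    proof eventually_elim
      case (elim p)
      define o1 where "o1 = oriented_indicator (\<rho>' (fst p)) (snd p)"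
      define o2 where "o2 = oriented_indicator (\<rho> (fst p)) (snd p)"
      define i where "i = (indicator {\<rho>' (fst p) - \<delta>..\<rho>' (fst p)} (snd p) :: real)"
      have "o1 - o2 \<le> i" unfolding o1_def o2_def i_def by (rule oriented_indicator_drop_le[OF drop \<delta>])
      then have "\<phi> u p * (o1 - o2) \<le> \<phi> u p * i" using elim by (intro mult_left_mono) auto
      also have "\<dots> \<le> m (fst p) * i" using elim by (intro mult_right_mono) (auto simp: i_def)
      finally have 1: "\<phi> u p * (o1 - o2) \<le> m (fst p) * i" .
      have "(\<phi> u' p - \<phi> u p) * o1 \<le> \<bar>\<phi> u' p - \<phi> u p\<bar> * \<bar>o1\<bar>" by (simp add: abs_mult[symmetric])
      also have "\<dots> \<le> \<bar>\<phi> u' p - \<phi> u p\<bar> * 1"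
        by (intro mult_left_mono) (auto simp: o1_def oriented_indicator_def)
      finally have 2: "(\<phi> u' p - \<phi> u p) * o1 \<le> norm (u' - u) * k p" using elim by (simp add: mult.commute)
      show ?case using 1 2 unfolding o1_def[symmetric] o2_def[symmetric] i_def[symmetric]
        by (simp add: algebra_simps)
    qed
  qed (use int h k in \<open>auto simp: lborel_prod\<close>)
  also have "\<dots> = \<delta> * (\<integral>r. m r \<partial>lborel) + norm (u' - u) * (\<integral>p. k p \<partial>lborel)"
    using h k h_eq by (simp add: lborel_prod)
  finally show ?thesis .
qed

section \<open>Increments of the solution\<close>

lemma play_bounded:
  assumes q: "q \<in> G_R T" and r: "r > 0" and t: "0 \<le> t" "t \<le> T"
    and B: "B \<ge> 0" "\<And>x. 0 \<le> x \<Longrightarrow> x \<le> T \<Longrightarrow> \<bar>q x\<bar> \<le> B"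
  shows "\<bar>play T r q t\<bar> \<le> B"
proof -
  have T: "0 \<le> T" using t by simp
  note play = play_is_play[OF T q r]
  have init: "\<bar>play T r q 0\<bar> \<le> B"
    using is_playD(4)[OF play] B(1) B(2)[of 0] T r by (auto simp: max_def min_def)
  have "\<sigma> * play T r q t \<le> B" if \<sigma>: "\<sigma> = 1 \<or> \<sigma> = -1" for \<sigma>
  proof -
    have "\<sigma> * play T r q t \<le> max (\<sigma> * play T r q 0) B"
    proof (rule play_moves_only_at_threshold[OF G_RD(3)[OF q] play _ t \<sigma>])
      show "\<sigma> * q x - r \<le> B" if "0 < x" "x \<le> t" for x using B(2)[of x] that t r \<sigma> by auto
    qed simp
    then show ?thesis using init \<sigma> by auto
  qed
  from this[of 1] this[of "-1"] show ?thesis by simp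
qed

text \<open>
  For \<open>\<sigma> = 1\<close>: downward motion of \<open>\<xi>\<^sub>r\<close> needs \<open>q + r\<close> below \<open>\<xi>\<^sub>r\<close>; at time \<open>s\<close> it was above, and it has
  since come down by at most \<open>\<delta>\<close>.
\<close>

lemma play_drop:
  assumes q: "q \<in> G_R T" and r: "r > 0" and st: "0 \<le> s" "s \<le> t" "t \<le> T"
    and \<sigma>: "\<sigma> = 1 \<or> \<sigma> = -1" and \<delta>: "\<delta> \<ge> 0"
    and low: "\<And>x. s \<le> x \<Longrightarrow> x \<le> t \<Longrightarrow> \<sigma> * q s - \<delta> \<le> \<sigma> * q x"
  shows "\<sigma> * play T r q s - \<delta> \<le> \<sigma> * play T r q t"
proof -
  have T: "0 \<le> T" using st by simp
  note play = play_is_play[OF T q r]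
  have "(- \<sigma>) * play T r q t \<le> max ((- \<sigma>) * play T r q s) (- \<sigma> * q s + \<delta> - r)"
  proof (rule play_moves_only_at_threshold[OF G_RD(3)[OF q] play st])
    show "- \<sigma> * q x - r \<le> - \<sigma> * q s + \<delta> - r" if "s < x" "x \<le> t" for x
      using low[of x] that by simp
  qed (use \<sigma> in auto)
  moreover have "- \<sigma> * q s - r \<le> (- \<sigma>) * play T r q s"
    using is_playD(3)[OF play, of s] st \<sigma> by auto
  ultimately show ?thesis using \<delta> by (auto simp: le_max_iff_disj)
qed

lemma play_measurable_in_threshold:
  assumes q: "q \<in> G_R T" and t: "0 \<le> t" "t \<le> T"
  shows "(\<lambda>r. if r \<in> {0<..} then play T r q t else 0) \<in> borel_measurable borel"
proof (rule borel_measurable_continuous_on_if)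
  have T: "0 \<le> T" using t by simp
  show "continuous_on {0<..} (\<lambda>r. play T r q t)"
  proof (rule continuous_onI)
    fix r e :: real assume r: "r \<in> {0<..}" and e: "e > 0"
    show "\<exists>d>0. \<forall>r'\<in>{0<..}. dist r' r < d \<longrightarrow> dist (play T r' q t) (play T r q t) \<le> e"
    proof (intro exI[of _ e] conjI ballI impI e)
      fix r' assume r': "r' \<in> {0<..}" "dist r' r < e"
      have "\<bar>play T r' q t - play T r q t\<bar> \<le> \<bar>r' - r\<bar>"
        by (rule play_Lipschitz_threshold[OF G_RD(3)[OF q] play_is_play[OF T q] play_is_play[OF T q] t])
           (use r r' in auto)
      then show "dist (play T r' q t) (play T r q t) \<le> e" using r'(2) by (simp add: dist_real_def)
    qed
  qed
qed auto

text \<open>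
  In \<open>q t - q s = (w t - w s) + (P s - P t)\<close> with \<open>P\<close> the Preisach term, the last difference is bounded
  because the plays have dropped by at most \<open>\<delta>\<close> while \<open>u\<close> has moved by \<open>u t - u s\<close>. For \<open>\<sigma> = -1\<close> the roles
  of \<open>s\<close> and \<open>t\<close> in the integral estimate are exchanged.
\<close>

lemma preisach_equation_increment:
  fixes \<psi> :: "real ^ 'l::finite \<Rightarrow> real \<Rightarrow> real \<Rightarrow> real"
  assumes dens: "preisach_density \<psi>" and q: "q \<in> G_R T" and T: "0 \<le> T"
    and eq: "\<forall>t\<in>{0..T}. q t + preisach T \<psi> u q t = w t"
  obtains A C where "A \<ge> 0" "C \<ge> 0"
    "\<And>\<sigma> s t \<delta>. \<sigma> = 1 \<or> \<sigma> = -1 \<Longrightarrow> 0 \<le> s \<Longrightarrow> s \<le> t \<Longrightarrow> t \<le> T \<Longrightarrow> \<delta> \<ge> 0 \<Longrightarrow>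
       (\<And>x. s \<le> x \<Longrightarrow> x \<le> t \<Longrightarrow> \<sigma> * q s - \<delta> \<le> \<sigma> * q x) \<Longrightarrow>
       \<sigma> * (q t - q s) \<le> \<bar>w t - w s\<bar> + C * norm (u t - u s) + A * \<delta>"
proof -
  obtain \<phi> m k where \<phi>: "borel_density \<phi> m k"
    "\<And>u. AE p in lborel. \<phi> u p = (if 0 < fst p then \<psi> u (fst p) (snd p) else 0)"
    using preisach_density_borel[OF dens] by blast
  obtain B where B: "B \<ge> 0" "\<And>t. 0 \<le> t \<Longrightarrow> t \<le> T \<Longrightarrow> \<bar>q t\<bar> \<le> B" using G_R_bounded[OF q T] by blast
  \<comment> \<open>absolute values make the nonnegativity of the constants immediate\<close>
  define A where "A = (\<integral>r. \<bar>m r\<bar> \<partial>lborel)"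
  define C where "C = (\<integral>p. \<bar>k p\<bar> \<partial>lborel)"
  have mk: "integrable lborel m" "integrable lborel k" using \<phi>(1) by (auto simp: borel_density_def)
  have AC: "(\<integral>r. m r \<partial>lborel) \<le> A" "(\<integral>p. k p \<partial>lborel) \<le> C"
    unfolding A_def C_def by (rule integral_mono[OF _ integrable_abs]; use mk in simp)+
  define \<rho> where "\<rho> t = (\<lambda>r. if r \<in> {0<..} then play T r q t else 0)" for t
  define P where "P t = (\<integral>p. \<phi> (u t) p * oriented_indicator (\<rho> t (fst p)) (snd p) \<partial>lborel)" for t
  have \<rho>: "\<rho> t \<in> borel_measurable borel" "\<bar>\<rho> t r\<bar> \<le> B" if "0 \<le> t" "t \<le> T" for t r
    using play_measurable_in_threshold[OF q that] play_bounded[OF q _ that B] B(1) by (auto simp: \<rho>_def)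
  have P: "preisach T \<psi> u q t = P t" if t: "0 \<le> t" "t \<le> T" for t
  proof -
    have "preisach T \<psi> u q t = (LINT r:{0<..}|lebesgue. LINT v=0..ereal (\<rho> t r)|lebesgue. \<psi> (u t) r v)"
      unfolding preisach_def set_lebesgue_integral_def
      by (intro Bochner_Integration.integral_cong) (auto simp: \<rho>_def indicator_def)
    then show ?thesis using preisach_integral_eq[where \<psi>=\<psi>, OF \<phi>(1) \<phi>(2)[of "u t"] \<rho>[OF t]] by (simp add: P_def)
  qed
  have drop: "P s - P t \<le> \<delta> * A + norm (u t - u s) * C"
    if "s \<in> {0..T}" "t \<in> {0..T}" "\<delta> \<ge> 0" "\<And>r. r > 0 \<Longrightarrow> play T r q s - \<delta> \<le> play T r q t" for s t \<delta>
  proof -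
    have "P s - P t \<le> \<delta> * (\<integral>r. m r \<partial>lborel) + norm (u s - u t) * (\<integral>p. k p \<partial>lborel)"
      unfolding P_def
      by (rule density_integral_drop_le[where B = B, OF \<phi>(1)]) (use that \<rho> in \<open>auto simp: \<rho>_def\<close>)
    also have "\<dots> \<le> \<delta> * A + norm (u s - u t) * C"
      using AC that by (intro add_mono mult_left_mono) auto
    finally show ?thesis by (simp add: norm_minus_commute)
  qed
  have "\<sigma> * (q t - q s) \<le> \<bar>w t - w s\<bar> + C * norm (u t - u s) + A * \<delta>"
    if \<sigma>: "\<sigma> = 1 \<or> \<sigma> = -1" and st: "0 \<le> s" "s \<le> t" "t \<le> T" and \<delta>: "\<delta> \<ge> 0"
      and low: "\<And>x. s \<le> x \<Longrightarrow> x \<le> t \<Longrightarrow> \<sigma> * q s - \<delta> \<le> \<sigma> * q x" for \<sigma> s t \<delta>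
  proof -
    have mono: "\<sigma> * play T r q s - \<delta> \<le> \<sigma> * play T r q t" if "r > 0" for r
      by (rule play_drop[OF q that st \<sigma> \<delta> low])
    have "\<sigma> * (P s - P t) \<le> \<delta> * A + norm (u t - u s) * C"
      using \<sigma>
    proof
      assume "\<sigma> = 1"
      then show ?thesis using drop[of s t \<delta>] mono st \<delta> by simp
    next
      assume "\<sigma> = -1"
      then show ?thesis using drop[of t s \<delta>] mono st \<delta> by (simp add: norm_minus_commute algebra_simps)
    qed
    moreover have "\<sigma> * (q t - q s) = \<sigma> * (w t - w s) + \<sigma> * (P s - P t)"
    proof -
      have "q t + P t = w t" "q s + P s = w s" using eq P st by auto
      then show ?thesis by (simp add: algebra_simps flip: \<open>q t + P t = w t\<close> \<open>q s + P s = w s\<close>)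
    qed
    moreover have "\<sigma> * (w t - w s) \<le> \<bar>w t - w s\<bar>" using \<sigma> by auto
    ultimately show ?thesis by (simp add: algebra_simps)
  qed
  moreover have "A \<ge> 0" "C \<ge> 0" by (simp_all add: A_def C_def)
  ultimately show thesis using that by blast
qed

section \<open>Regularity of the solution\<close>

text \<open>
  The subcells \<open>[l K, h K]\<close> form a division again, with smaller total length. Degenerate subcells are
  discarded first: two of them may coincide when their cells share an end point, so the map from
  cells to subcells is injective only on the others.
\<close>

lemma abs_continuous_on_subcells:
  fixes f :: "real \<Rightarrow> 'a::real_normed_vector"
  assumes f: "abs_continuous_on a b f" and "\<epsilon> > 0"
  shows "\<exists>\<delta>>0. \<forall>D S l h. D division_of S \<and> S \<subseteq> {a..b} \<and> (\<Sum>K\<in>D. Sup K - Inf K) < \<delta> \<and>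
       (\<forall>K\<in>D. Inf K \<le> l K \<and> l K \<le> h K \<and> h K \<le> Sup K) \<longrightarrow>
       (\<Sum>K\<in>D. norm (f (h K) - f (l K))) < \<epsilon>"
proof -
  obtain \<delta> where \<delta>: "\<delta> > 0" and ac: "\<And>D S. D division_of S \<Longrightarrow> S \<subseteq> {a..b} \<Longrightarrow> (\<Sum>K\<in>D. Sup K - Inf K) < \<delta> \<Longrightarrow>
        (\<Sum>K\<in>D. norm (f (Sup K) - f (Inf K))) < \<epsilon>"
    using f \<open>\<epsilon> > 0\<close> unfolding abs_continuous_on_def by metis
  have "(\<Sum>K\<in>D. norm (f (h K) - f (l K))) < \<epsilon>"
    if D: "D division_of S" and S: "S \<subseteq> {a..b}" and small: "(\<Sum>K\<in>D. Sup K - Inf K) < \<delta>"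
      and lh: "\<And>K. K \<in> D \<Longrightarrow> Inf K \<le> l K \<and> l K \<le> h K \<and> h K \<le> Sup K" for D S l h
  proof -
    define E where "E = {K \<in> D. l K < h K}"
    define c where "c K = {l K..h K}" for K
    have fin: "finite D" "finite E" using D by (auto simp: E_def)
    have cell: "c K \<subseteq> K" if K: "K \<in> D" for K
    proof -
      obtain x y where "K = cbox x y" using division_ofD(4)[OF D K] by blast
      moreover have "K \<noteq> {}" using division_ofD(3)[OF D K] .
      ultimately have "K = {Inf K..Sup K}" by auto
      then show ?thesis using lh[OF K] unfolding c_def by (metis atLeastatMost_subset_iff)
    qed
    have disjoint: "interior (c K) \<inter> interior (c K') = {}" if "K \<in> E" "K' \<in> E" "K \<noteq> K'" for K K'
    proof -
      have "interior K \<inter> interior K' = {}" using division_ofD(5)[OF D] that by (simp add: E_def)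
      moreover have "interior (c K) \<subseteq> interior K" "interior (c K') \<subseteq> interior K'"
        using cell that by (auto simp: E_def intro!: interior_mono)
      ultimately show ?thesis by blast
    qed
    have inj: "inj_on c E"
    proof (rule inj_onI, rule ccontr)
      fix K K' assume K: "K \<in> E" "K' \<in> E" "c K = c K'" "K \<noteq> K'"
      then have "interior (c K) = {}" using disjoint[of K K'] by simp
      then show False using K(1) by (simp add: c_def E_def)
    qed
    have ends: "Inf (c K) = l K" "Sup (c K) = h K" if "K \<in> E" for K
      using that by (auto simp: E_def c_def)
    have "(c ` E) division_of \<Union>(c ` E)"
      unfolding division_of_def
    proof (intro conjI ballI impI)
      show "finite (c ` E)" using fin by simp
      fix X assume X: "X \<in> c ` E"
      then show "X \<subseteq> \<Union>(c ` E)" "X \<noteq> {}" "\<exists>x y. X = cbox x y"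
        by (auto simp: c_def E_def)
      show "interior X \<inter> interior Y = {}" if "Y \<in> c ` E" "X \<noteq> Y" for Y
        using X that disjoint by blast
    qed simp
    moreover have "\<Union>(c ` E) \<subseteq> {a..b}"
    proof -
      have "c K \<subseteq> {a..b}" if "K \<in> E" for K
        using cell[of K] division_ofD(2)[OF D, of K] S that by (auto simp: E_def)
      then show ?thesis by blast
    qed
    moreover have "(\<Sum>X\<in>c ` E. Sup X - Inf X) < \<delta>"
    proof -
      have "(\<Sum>X\<in>c ` E. Sup X - Inf X) = (\<Sum>K\<in>E. h K - l K)"
        using inj by (simp add: sum.reindex ends)
      also have "\<dots> \<le> (\<Sum>K\<in>E. Sup K - Inf K)"
        using lh by (intro sum_mono) (force simp: E_def)
      also have "\<dots> \<le> (\<Sum>K\<in>D. Sup K - Inf K)"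
        using fin lh by (intro sum_mono2) (force simp: E_def)+
      finally show ?thesis using small by simp
    qed
    ultimately have "(\<Sum>X\<in>c ` E. norm (f (Sup X) - f (Inf X))) < \<epsilon>" by (rule ac)
    also have "(\<Sum>X\<in>c ` E. norm (f (Sup X) - f (Inf X))) = (\<Sum>K\<in>E. norm (f (h K) - f (l K)))"
      using inj by (simp add: sum.reindex ends)
    also have "\<dots> = (\<Sum>K\<in>D. norm (f (h K) - f (l K)))"
    proof (rule sum.mono_neutral_left)
      show "\<forall>K\<in>D - E. norm (f (h K) - f (l K)) = 0"
        using lh by (force simp: E_def)
    qed (use fin in \<open>auto simp: E_def\<close>)
    finally show ?thesis .
  qed
  then show ?thesis using \<delta> by (intro exI[of _ \<delta>]) blast
qed

lemma abs_continuous_on_dominated: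
  fixes f :: "real \<Rightarrow> 'a::real_normed_vector" and g :: "real \<Rightarrow> 'b::real_normed_vector"
    and q :: "real \<Rightarrow> 'c::real_normed_vector"
  assumes f: "abs_continuous_on a b f" and g: "abs_continuous_on a b g" and C: "C \<ge> 0"
    and dom: "\<And>s t. a \<le> s \<Longrightarrow> s \<le> t \<Longrightarrow> t \<le> b \<Longrightarrow>
      \<exists>s' t'. s \<le> s' \<and> s' \<le> t' \<and> t' \<le> t \<and> norm (q t - q s) \<le> norm (f t' - f s') + C * norm (g t' - g s')"
  shows "abs_continuous_on a b q"
  unfolding abs_continuous_on_def
proof (intro allI impI)
  fix \<epsilon> :: real assume \<epsilon>: "\<epsilon> > 0"
  then have e: "\<epsilon>/2 > 0" "\<epsilon> / (2 * (C + 1)) > 0" using C by auto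
  obtain \<delta>1 where \<delta>1: "\<delta>1 > 0"
    "\<forall>D S l h. D division_of S \<and> S \<subseteq> {a..b} \<and> (\<Sum>K\<in>D. Sup K - Inf K) < \<delta>1 \<and>
       (\<forall>K\<in>D. Inf K \<le> l K \<and> l K \<le> h K \<and> h K \<le> Sup K) \<longrightarrow>
       (\<Sum>K\<in>D. norm (f (h K) - f (l K))) < \<epsilon>/2"
    using abs_continuous_on_subcells[OF f e(1)] by blast
  obtain \<delta>2 where \<delta>2: "\<delta>2 > 0"
    "\<forall>D S l h. D division_of S \<and> S \<subseteq> {a..b} \<and> (\<Sum>K\<in>D. Sup K - Inf K) < \<delta>2 \<and>
       (\<forall>K\<in>D. Inf K \<le> l K \<and> l K \<le> h K \<and> h K \<le> Sup K) \<longrightarrow>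
       (\<Sum>K\<in>D. norm (g (h K) - g (l K))) < \<epsilon> / (2 * (C + 1))"
    using abs_continuous_on_subcells[OF g e(2)] by blast
  have "(\<Sum>K\<in>D. norm (q (Sup K) - q (Inf K))) < \<epsilon>"
    if D: "D division_of S" and S: "S \<subseteq> {a..b}" and small: "(\<Sum>K\<in>D. Sup K - Inf K) < min \<delta>1 \<delta>2" for D S
  proof -
    have "\<exists>s t. Inf K \<le> s \<and> s \<le> t \<and> t \<le> Sup K \<and>
        norm (q (Sup K) - q (Inf K)) \<le> norm (f t - f s) + C * norm (g t - g s)" if K: "K \<in> D" for K
    proof (rule dom)
      obtain x y where "K = cbox x y" using division_ofD(4)[OF D K] by blast
      moreover have "K \<noteq> {}" "K \<subseteq> {a..b}" using division_ofD(2,3)[OF D K] S by auto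
      ultimately show "a \<le> Inf K" "Inf K \<le> Sup K" "Sup K \<le> b" by auto
    qed
    then obtain l h where lh: "\<And>K. K \<in> D \<Longrightarrow> Inf K \<le> l K \<and> l K \<le> h K \<and> h K \<le> Sup K"
      and le: "\<And>K. K \<in> D \<Longrightarrow> norm (q (Sup K) - q (Inf K)) \<le> norm (f (h K) - f (l K)) + C * norm (g (h K) - g (l K))"
      by metis
    have "(\<Sum>K\<in>D. norm (q (Sup K) - q (Inf K))) \<le>
        (\<Sum>K\<in>D. norm (f (h K) - f (l K))) + C * (\<Sum>K\<in>D. norm (g (h K) - g (l K)))"
      unfolding sum_distrib_left sum.distrib[symmetric] by (rule sum_mono) (rule le)
    also have "\<dots> < \<epsilon>/2 + \<epsilon>/2"
    proof (rule add_less_le_mono)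
      show "(\<Sum>K\<in>D. norm (f (h K) - f (l K))) < \<epsilon>/2"
        by (rule \<delta>1(2)[rule_format]) (use D S small lh in auto)
      have "(\<Sum>K\<in>D. norm (g (h K) - g (l K))) \<le> \<epsilon> / (2 * (C + 1))"
        by (rule less_imp_le, rule \<delta>2(2)[rule_format]) (use D S small lh in auto)
      then have "C * (\<Sum>K\<in>D. norm (g (h K) - g (l K))) \<le> C * (\<epsilon> / (2 * (C + 1)))"
        using C by (rule mult_left_mono)
      also have "\<dots> \<le> \<epsilon>/2" using C \<epsilon> by (simp add: field_simps)
      finally show "C * (\<Sum>K\<in>D. norm (g (h K) - g (l K))) \<le> \<epsilon>/2" .
    qed
    finally show ?thesis by simp
  qed
  then show "\<exists>\<delta>>0. \<forall>D S. D division_of S \<and> S \<subseteq> {a..b} \<and> (\<Sum>K\<in>D. Sup K - Inf K) < \<delta> \<longrightarrow>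
        (\<Sum>K\<in>D. norm (q (Sup K) - q (Inf K))) < \<epsilon>"
    using \<delta>1(1) \<delta>2(1) by (intro exI[of _ "min \<delta>1 \<delta>2"]) auto
qed

lemma continuous_on_Icc_of_one_sided:
  fixes f :: "real \<Rightarrow> real"
  assumes right: "\<And>t. a \<le> t \<Longrightarrow> t < b \<Longrightarrow> (f \<longlongrightarrow> f t) (at_right t)"
    and left: "\<And>t. a < t \<Longrightarrow> t \<le> b \<Longrightarrow> (f \<longlongrightarrow> f t) (at_left t)"
  shows "continuous_on {a..b} f"
proof (rule continuous_onI)
  fix t e :: real assume t: "t \<in> {a..b}" and e: "e > 0"
  obtain c where c: "c < t" "\<And>y. c < y \<Longrightarrow> y < t \<Longrightarrow> a \<le> y \<Longrightarrow> \<bar>f y - f t\<bar> < e"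
  proof (cases "a < t")
    case True
    then show ?thesis using left[of t] t e that unfolding tendsto_at_left_real_iff by force
  qed (use that[of "t - 1"] in auto)
  obtain d where d: "d > t" "\<And>y. t < y \<Longrightarrow> y < d \<Longrightarrow> y \<le> b \<Longrightarrow> \<bar>f y - f t\<bar> < e"
  proof (cases "t < b")
    case True
    then show ?thesis using right[of t] t e that unfolding tendsto_at_right_real_iff by force
  qed (use that[of "t + 1"] in auto)
  show "\<exists>\<delta>>0. \<forall>y\<in>{a..b}. dist y t < \<delta> \<longrightarrow> dist (f y) (f t) \<le> e"
  proof (intro exI[of _ "min (t - c) (d - t)"] conjI ballI impI)
    fix y assume y: "y \<in> {a..b}" "dist y t < min (t - c) (d - t)"
    then show "dist (f y) (f t) \<le> e"
      using c(2)[of y] d(2)[of y] e by (cases y t rule: linorder_cases) (auto simp: dist_real_def)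
  qed (use c d in auto)
qed

theorem proposition5p1:
  fixes T :: real
    and \<psi> :: "real ^ 'l::finite \<Rightarrow> real \<Rightarrow> real \<Rightarrow> real"
    and u :: "real \<Rightarrow> real ^ 'l"
    and w q :: "real \<Rightarrow> real"
  assumes "T > 0"
    and "preisach_density \<psi>"
    and "continuous_on {0..T} u"
    and "continuous_on {0..T} w"
    and "q \<in> G_R T"
    and "\<forall>t\<in>{0..T}. q t + preisach T \<psi> u q t = w t"
  shows "continuous_on {0..T} q \<and>
         (abs_continuous_on 0 T u \<and> abs_continuous_on 0 T w \<longrightarrow> abs_continuous_on 0 T q)"
proof -
  have T: "0 \<le> T" using assms(1) by simp
  obtain A C where AC: "A \<ge> 0" "C \<ge> 0"
    and incr: "\<And>\<sigma> s t \<delta>. \<sigma> = 1 \<or> \<sigma> = -1 \<Longrightarrow> 0 \<le> s \<Longrightarrow> s \<le> t \<Longrightarrow> t \<le> T \<Longrightarrow> \<delta> \<ge> 0 \<Longrightarrow>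
       (\<And>x. s \<le> x \<Longrightarrow> x \<le> t \<Longrightarrow> \<sigma> * q s - \<delta> \<le> \<sigma> * q x) \<Longrightarrow>
       \<sigma> * (q t - q s) \<le> \<bar>w t - w s\<bar> + C * norm (u t - u s) + A * \<delta>"
    using preisach_equation_increment[OF assms(2,5) T assms(6)] by metis
  have left: "(q \<longlongrightarrow> q t) (at_left t)" if t: "0 < t" "t \<le> T" for t
  proof -
    obtain l where l: "(q \<longlongrightarrow> l) (at_left t)" using G_RD(2)[OF assms(5) t] by blast
    have w_lim: "(w \<longlongrightarrow> w t) (at_left t)" and u_lim: "(u \<longlongrightarrow> u t) (at_left t)"
      using continuous_on_subset[OF assms(4), of "{0..t}"] continuous_on_subset[OF assms(3), of "{0..t}"] t
      by (auto intro!: continuous_on_Icc_at_leftD)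
    have no_jump: "\<sigma> * (q t - l) \<le> 0" if \<sigma>: "\<sigma> = 1 \<or> \<sigma> = -1" for \<sigma>
    proof (rule ccontr)
      assume pos: "\<not> \<sigma> * (q t - l) \<le> 0"
      \<comment> \<open>\<open>\<epsilon> M\<close> will bound the jump, so \<open>\<epsilon>\<close> is chosen to make this half of the jump\<close>
      define M where "M = 2 + C + 2 * A"
      define \<epsilon> where "\<epsilon> = \<sigma> * (q t - l) / (2 * M)"
      have M: "M > 0" using AC by (simp add: M_def)
      then have \<epsilon>: "\<epsilon> > 0" "\<sigma> * (q t - l) = 2 * (\<epsilon> * M)" using pos by (auto simp: \<epsilon>_def)
      obtain b where b: "b < t" "\<And>x. b < x \<Longrightarrow> x < t \<Longrightarrow> \<bar>q x - l\<bar> < \<epsilon>"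
        using l \<epsilon>(1) unfolding tendsto_at_left_real_iff by blast
      have "\<forall>\<^sub>F s in at_left t. dist (w s) (w t) < \<epsilon> \<and> dist (u s) (u t) < \<epsilon> \<and> max b 0 < s \<and> s < t"
        by (intro eventually_conj tendstoD[OF w_lim \<epsilon>(1)] tendstoD[OF u_lim \<epsilon>(1)])
           (use b t in \<open>auto simp: eventually_at_left_field intro!: exI[of _ "max b 0"]\<close>)
      then obtain s where s: "dist (w s) (w t) < \<epsilon>" "dist (u s) (u t) < \<epsilon>" "b < s" "0 < s" "s < t"
        using eventually_happens'[OF trivial_limit_at_left_real] by fastforce
      have qs: "\<bar>q s - l\<bar> < \<epsilon>" using b(2) s by simp
      have "\<sigma> * (q t - q s) \<le> \<bar>w t - w s\<bar> + C * norm (u t - u s) + A * (2 * \<epsilon>)"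
      proof (rule incr[OF \<sigma>])
        show "\<sigma> * q s - 2 * \<epsilon> \<le> \<sigma> * q x" if x: "s \<le> x" "x \<le> t" for x
        \<comment> \<open>at \<open>x = t\<close> the bound holds because the jump goes in the direction \<open>\<sigma>\<close>\<close>
        proof (cases "x = t")
          case True
          then show ?thesis using qs pos \<sigma> \<epsilon>(1) by (auto simp: abs_less_iff)
        next
          case False
          then have "\<bar>q x - l\<bar> < \<epsilon>" using b(2) x s by simp
          then show ?thesis using qs \<sigma> by (auto simp: abs_less_iff)
        qed
      qed (use s t \<epsilon> in auto)
      also have "\<dots> \<le> \<epsilon> + C * \<epsilon> + A * (2 * \<epsilon>)"
        using s(1,2) AC
        by (intro add_mono mult_left_mono) (auto simp: dist_norm norm_minus_commute abs_minus_commute)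
      finally have "\<sigma> * (q t - l) \<le> \<epsilon> * M"
        using qs \<sigma> by (auto simp: M_def algebra_simps abs_less_iff)
      then show False using \<epsilon> M by (simp add: zero_less_mult_iff)
    qed
    have "q t = l" using no_jump[of 1] no_jump[of "-1"] by simp
    then show ?thesis using l by simp
  qed
  have cont: "continuous_on {0..T} q"
    by (rule continuous_on_Icc_of_one_sided[OF G_RD(1)[OF assms(5)] left])
  moreover have "abs_continuous_on 0 T q" if ac: "abs_continuous_on 0 T u" "abs_continuous_on 0 T w"
  proof (rule abs_continuous_on_dominated[OF ac(2,1) AC(2)])
    fix s t assume st: "0 \<le> s" "s \<le> t" "t \<le> T"
    have cst: "continuous_on {s..t} q" by (rule continuous_on_subset[OF cont]) (use st in auto)
    obtain x where x: "x \<in> {s..t}" "\<And>z. z \<in> {s..t} \<Longrightarrow> q x \<le> q z"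
      using continuous_attains_inf[OF compact_Icc _ cst] st by auto
    obtain y where y: "y \<in> {s..t}" "\<And>z. z \<in> {s..t} \<Longrightarrow> q z \<le> q y"
      using continuous_attains_sup[OF compact_Icc _ cst] st by auto
    \<comment> \<open>the extrema are taken in their order of time, with \<open>\<sigma> = 1\<close> or \<open>\<sigma> = -1\<close> accordingly\<close>
    have osc: "norm (q t - q s) \<le> q y - q x" using x(2)[of s] x(2)[of t] y(2)[of s] y(2)[of t] st by auto
    show "\<exists>s' t'. s \<le> s' \<and> s' \<le> t' \<and> t' \<le> t \<and>
        norm (q t - q s) \<le> norm (w t' - w s') + C * norm (u t' - u s')"
    proof (cases "x \<le> y")
      case True
      have "1 * (q y - q x) \<le> \<bar>w y - w x\<bar> + C * norm (u y - u x) + A * 0"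
        by (rule incr) (use True x y st in auto)
      then show ?thesis using osc True x(1) y(1) by (intro exI[of _ x] exI[of _ y]) auto
    next
      case False
      have "-1 * (q x - q y) \<le> \<bar>w x - w y\<bar> + C * norm (u x - u y) + A * 0"
        by (rule incr) (use False x y st in auto)
      then show ?thesis using osc False x(1) y(1) by (intro exI[of _ y] exI[of _ x]) auto
    qed
  qed
  ultimately show ?thesis by blast
qed

end
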